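(* Fix $p\in[1,\infty]$ and $\alpha\in(0,1)$. Let $\{X_i\}_{i=1}^n$ be an i.i.d. sample of nonnegative random variables with common distribution function $F$ on $\mathbf R_+$ admitting a density $f$. Suppose that: (a) $F$ is twice continuously differentiable on $\mathbf R_+$, $\bar\beta(\epsilon)\equiv\inf_{0\le x\le F^{-1}(1-\epsilon)}\{-f'(x)/f^2(x)\}\asymp 1$ as $\epsilon\to0$, and $\big[\int_0^\infty\sqrt{|F''(x)|}\,dx\big]^2<\infty$; (b) $\{t_n\}$ is a sequence of positive scalars with $t_n\downarrow0$ and $t_n\sqrt n\to\infty$ as $n\to\infty$, and $\{\kappa_n\}$ is a sequence of positive scalars with $\kappa_n\downarrow0$ and $(\log n)^{2/3}n^{-1/6}/\kappa_n\to0$ as $n\to\infty$; (c) the cdf of $\|\mathcal M_F'(\mathbb G)-\mathbb G\|_p$ is continuous and strictly increasing at its $(1-\alpha)$th quantile $c^*_{1-\alpha}$ when $F$ is non-strictly concave (concave but not strictly concave). Let $\hat c_{1-\alpha}=\max\{\kappa_n,\hat c^*_{1-\alpha}\}$ with $\hat c^*_{1-\alpha}$ the rescaled-bootstrap quantile defined in the context. Then, under $\mathrm H_0:\phi(F)=0$, $$\limsup_{n\to\infty}P(\sqrt n\,\phi(\mathbb F_n)>\hat c_{1-\alpha})\le\alpha,$$ and under $\mathrm H_1:\phi(F)>0$, $$\lim_{n\to\infty}P(\sqrt n\,\phi(\mathbb F_n)>\hat c_{1-\alpha})=1.$$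
   Context: $\mathbf R_+=[0,\infty)$; $\ell^\infty(T)$ is the space of bounded real functions on $T$ with the sup norm; $C_0(\mathbf R_+)$ is the space of continuous functions on $\mathbf R_+$ vanishing at infinity. $F^{-1}$ is the quantile function of $F$. $u(\epsilon)\asymp v(\epsilon)$ as $\epsilon\downarrow 0$ (for nonnegative $u,v$) means that $u/v$ and $v/u$ are both bounded as $\epsilon\downarrow0$. Least concave majorant (LCM): for convex $T\subseteq\mathbf R_+$ and $\theta\in\ell^\infty(\mathbf R_+)$, $\mathcal M_T\theta(x)=\inf\{g(x):g\in\ell^\infty(T),\ g\text{ concave},\ \theta\le g\text{ on }T\}$ for $x\in T$, and $\mathcal M=\mathcal M_{\mathbf R_+}$. Norm: fix a known positive weighting function $g\in L^1(\mathbf R_+)$; $\|\theta\|_p=[\int_{\mathbf R_+}|\theta(x)|^pg(x)\,dx]^{1/p}$ for $p\in[1,\infty)$ and $\|\theta\|_\infty=\sup_{x\in\mathbf R_+}|\theta(x)|$. Set $\phi(\theta)=\|\mathcal M\theta-\theta\|_p$. For concave $F$, $\mathcal M_F':C_0(\mathbf R_+)\to\ell^\infty(\mathbf R_+)$ is $(\mathcal M_F'h)(x)=(\mathcal M_{T_{F,x}}h)(x)$, where $T_{F,x}=\{x\}\cup U_{F,x}$ and $U_{F,x}$ is the union of all open intervals $A\subseteq\mathbf R_+$ with $x\in A$ such that $F$ is affine over $A$. $\mathbb G=\mathbb B\circ F$ with $\mathbb B$ a standard Brownian bridge on $[0,1]$. $\mathbb F_n$ is the empirical distribution function of $X_1,\ldots,X_n$.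 Bootstrap: $\mathbb F_n^*(x)=\frac1n\sum_{i=1}^nW_{ni}1\{X_i\le x\}$, where $(W_{n1},\ldots,W_{nn})$ is multinomial ($n$ draws, $n$ categories, probabilities $(1/n,\ldots,1/n)$), independent of the data. For $h\in\ell^\infty(\mathbf R_+)$, $\hat{\mathcal M}_n'(h)=\{\mathcal M(\mathbb F_n+t_nh)-\mathcal M(\mathbb F_n)\}/t_n$. With $P_W$ the probability over the weights holding the data fixed, $$\hat c^*_{1-\alpha}=\inf\{c\in\mathbf R:P_W(\|\hat{\mathcal M}_n'(\sqrt n\{\mathbb F_n^*-\mathbb F_n\})-\sqrt n\{\mathbb F_n^*-\mathbb F_n\}\|_p\le c)\ge1-\alpha\}.$$ *)

theory Defs
  imports "HOL-Probability.Probability"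
begin

(* Functions on R_+ are represented by functions of type real => real of which only the values
   on {0..} are used. *)

definition strictly_concave_on :: "real set \<Rightarrow> (real \<Rightarrow> real) \<Rightarrow> bool" where
  "strictly_concave_on S F \<longleftrightarrow> convex S \<and>
     (\<forall>x\<in>S. \<forall>y\<in>S. \<forall>u. x \<noteq> y \<and> 0 < u \<and> u < 1 \<longrightarrow>
        (1 - u) * F x + u * F y < F ((1 - u) * x + u * y))"

definition affine_fun_on :: "real set \<Rightarrow> (real \<Rightarrow> real) \<Rightarrow> bool" where
  "affine_fun_on A F \<longleftrightarrow> (\<exists>a b. \<forall>y\<in>A. F y = a + b * y)"

(* For a cdf H and 0 < u < 1 the set is nonempty and bounded below, so the infimum is genuine. *)
definition quantile :: "(real \<Rightarrow> real) \<Rightarrow> real \<Rightarrow> real" where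
  "quantile H u = Inf {x. u \<le> H x}"

definition strictly_increasing_at :: "(real \<Rightarrow> real) \<Rightarrow> real \<Rightarrow> bool" where
  "strictly_increasing_at H x \<longleftrightarrow> (\<forall>y<x. H y < H x) \<and> (\<forall>y>x. H x < H y)"

subsection \<open>Least concave majorant\<close>

(* Meaningful for convex T, theta bounded on T and x in T: then the family of majorants is
   nonempty and their values at x are bounded below by theta x. *)
definition maj_on :: "real set \<Rightarrow> (real \<Rightarrow> real) \<Rightarrow> real \<Rightarrow> real" where
  "maj_on T \<theta> x =
     Inf {g x |g. bounded (g ` T) \<and> concave_on T g \<and> (\<forall>y\<in>T. \<theta> y \<le> g y)}"

abbreviation maj :: "(real \<Rightarrow> real) \<Rightarrow> real \<Rightarrow> real" where
  "maj \<equiv> maj_on {0..}"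

definition affine_nbhd :: "(real \<Rightarrow> real) \<Rightarrow> real \<Rightarrow> real set" where
  "affine_nbhd F x =
     {x} \<union> \<Union>{A. open A \<and> is_interval A \<and> A \<subseteq> {0..} \<and> x \<in> A \<and> affine_fun_on A F}"

definition maj_deriv :: "(real \<Rightarrow> real) \<Rightarrow> (real \<Rightarrow> real) \<Rightarrow> real \<Rightarrow> real" where
  "maj_deriv F h x = maj_on (affine_nbhd F x) h x"

subsection \<open>Weighted norms and the test functional\<close>

definition wnorm :: "(real \<Rightarrow> real) \<Rightarrow> ennreal \<Rightarrow> (real \<Rightarrow> real) \<Rightarrow> real" where
  "wnorm g p \<theta> =
     (if p = \<infinity> then (SUP x\<in>{0..}. \<bar>\<theta> x\<bar>)
      else (LINT x:{0..}|lebesgue. \<bar>\<theta> x\<bar> powr enn2real p * g x) powr (1 / enn2real p))"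

definition \<phi> :: "(real \<Rightarrow> real) \<Rightarrow> ennreal \<Rightarrow> (real \<Rightarrow> real) \<Rightarrow> real" where
  "\<phi> g p \<theta> = wnorm g p (\<lambda>x. maj \<theta> x - \<theta> x)"

subsection \<open>The standard Brownian bridge\<close>

(* Point masses count as (degenerate) Gaussian laws. *)
definition gaussian_law :: "real measure \<Rightarrow> bool" where
  "gaussian_law \<nu> \<longleftrightarrow> (\<exists>m. \<nu> = return borel m \<or>
     (\<exists>\<sigma>>0. \<nu> = density lborel (\<lambda>x. ennreal (normal_density m \<sigma> x))))"

(* Centred Gaussian process on [0,1] with continuous paths and covariance min s t - s t; joint
   Gaussianity is expressed through finite linear combinations of the coordinates. *)
definition brownian_bridge :: "'b measure \<Rightarrow> (real \<Rightarrow> 'b \<Rightarrow> real) \<Rightarrow> bool" where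
  "brownian_bridge N B \<longleftrightarrow>
     prob_space N \<and>
     (\<forall>t\<in>{0..1}. B t \<in> borel_measurable N) \<and>
     (\<forall>\<omega>\<in>space N. continuous_on {0..1} (\<lambda>t. B t \<omega>)) \<and>
     (\<forall>S a. finite S \<and> S \<subseteq> {0..1} \<longrightarrow>
        gaussian_law (distr N borel (\<lambda>\<omega>. \<Sum>t\<in>S. a t * B t \<omega>))) \<and>
     (\<forall>t\<in>{0..1}. (LINT \<omega>|N. B t \<omega>) = 0) \<and>
     (\<forall>s\<in>{0..1}. \<forall>t\<in>{0..1}. (LINT \<omega>|N. B s \<omega> * B t \<omega>) = min s t - s * t)"

(* The cdf of the norm of maj_deriv F G - G, where G is the composition of B with F. *)
definition limit_cdf ::
  "(real \<Rightarrow> real) \<Rightarrow> ennreal \<Rightarrow> (real \<Rightarrow> real) \<Rightarrow> 'b measure \<Rightarrow> (real \<Rightarrow> 'b \<Rightarrow> real) \<Rightarrow> real \<Rightarrow> real"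
where
  "limit_cdf g p F N B =
     cdf (distr N borel
       (\<lambda>\<omega>. let G = (\<lambda>x. B (F x) \<omega>) in wnorm g p (\<lambda>x. maj_deriv F G x - G x)))"

subsection \<open>Empirical distribution and bootstrap\<close>

(* A sample of size n is the tuple x 0, ..., x (n - 1). *)
definition ecdf :: "nat \<Rightarrow> (nat \<Rightarrow> real) \<Rightarrow> real \<Rightarrow> real" where
  "ecdf n x t = 1 / real n * (\<Sum>i<n. indicator {..t} (x i))"

definition boot_ecdf :: "nat \<Rightarrow> (nat \<Rightarrow> nat) \<Rightarrow> (nat \<Rightarrow> real) \<Rightarrow> real \<Rightarrow> real" where
  "boot_ecdf n w x t = 1 / real n * (\<Sum>i<n. real (w i) * indicator {..t} (x i))"

(* Multinomial law with n draws and n equally likely categories: category counts of n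
   independent uniform draws from {..<n}. *)
definition multinomial_weights :: "nat \<Rightarrow> (nat \<Rightarrow> nat) pmf" where
  "multinomial_weights n =
     map_pmf (\<lambda>d i. card {j. j < n \<and> d j = i})
       (Pi_pmf {..<n} 0 (\<lambda>_. pmf_of_set {..<n}))"

definition maj_deriv_est ::
  "nat \<Rightarrow> real \<Rightarrow> (nat \<Rightarrow> real) \<Rightarrow> (real \<Rightarrow> real) \<Rightarrow> real \<Rightarrow> real" where
  "maj_deriv_est n t x h y = (maj (\<lambda>z. ecdf n x z + t * h z) y - maj (ecdf n x) y) / t"

definition boot_stat ::
  "(real \<Rightarrow> real) \<Rightarrow> ennreal \<Rightarrow> nat \<Rightarrow> real \<Rightarrow> (nat \<Rightarrow> real) \<Rightarrow> (nat \<Rightarrow> nat) \<Rightarrow> real" where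
  "boot_stat g p n t x w =
     (let h = (\<lambda>y. sqrt (real n) * (boot_ecdf n w x y - ecdf n x y))
      in wnorm g p (\<lambda>y. maj_deriv_est n t x h y - h y))"

(* The weights are independent of the data, so the probability over the weights with the data x
   held fixed is the one under their multinomial law. *)
definition boot_quantile ::
  "(real \<Rightarrow> real) \<Rightarrow> ennreal \<Rightarrow> real \<Rightarrow> nat \<Rightarrow> real \<Rightarrow> (nat \<Rightarrow> real) \<Rightarrow> real" where
  "boot_quantile g p \<alpha> n t x =
     Inf {c. measure_pmf.prob (multinomial_weights n) {w. boot_stat g p n t x w \<le> c} \<ge> 1 - \<alpha>}"

definition critical_value ::
  "(real \<Rightarrow> real) \<Rightarrow> ennreal \<Rightarrow> real \<Rightarrow> nat \<Rightarrow> real \<Rightarrow> real \<Rightarrow> (nat \<Rightarrow> real) \<Rightarrow> real" where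
  "critical_value g p \<alpha> n t \<kappa> x = max \<kappa> (boot_quantile g p \<alpha> n t x)"

end

theory Submission
  imports Defs "HOL-Real_Asymp.Real_Asymp"
begin

text \<open>
  Under \<open>H\<^sub>0\<close> the function \<open>F\<close> is concave, so \<open>- f' / f\<^sup>2\<close> is nonnegative and its infimum, being
  bounded away from \<open>0\<close> in absolute value, gives \<open>f' \<le> - \<beta> * f\<^sup>2\<close> with \<open>\<beta> > 0\<close>. Hence the tangent of \<open>F\<close>
  at \<open>x\<close> exceeds \<open>F z\<close> by at least \<open>c * (F z - F x)\<^sup>2\<close>. Testing the least concave majorant of the empirical
  distribution against the line of slope \<open>f x\<close> bounds its distance to the empirical distribution by the supremum
  over \<open>z\<close> of the empirical-process increment minus \<open>c * (F z - F x)\<^sup>2\<close>, which is of order \<open>(ln n / n)\<close> to the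
  power \<open>2/3\<close> with probability tending to \<open>1\<close>.

  Under \<open>H\<^sub>1\<close> the statistic grows like the square root of \<open>n\<close>, while the bootstrap quantile is of smaller order:
  the majorant is 1-Lipschitz for the supremum norm, and the deviation of the bootstrap distribution from the
  empirical one vanishes uniformly over all data sets.
\<close>

subsection \<open>Least concave majorants\<close>

text \<open>Curvature and noise are both measured in increments of \<open>F\<close>. A gap quadratic
  in \<open>z - x\<close> cannot hold on the half-line, where tangents grow only linearly; but
  \<open>f' / f^2\<close> is the derivative of \<open>ln f\<close> with respect to \<open>F\<close>,
  so bounding it is a curvature bound on the scale of \<open>F\<close>. On that scale a stretch of
  mass \<open>u\<close> has empirical fluctuation of order \<open>sqrt (u * ln n / n)\<close>, which
  \<open>c * u^2\<close> dominates once \<open>u\<close> exceeds a multiple of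
  \<open>(ln n / n)\<close> to the power 1/3; what remains has the order stated above. Multiplied by
  \<open>sqrt n\<close> it becomes \<open>(ln n)\<close> to the 2/3 times \<open>n\<close> to the
  -1/6, negligible against the floor \<open>\<kappa> n\<close> of the critical value. Under the null
  hypothesis rejection is therefore excluded on events of probability tending to 1.

  The power claim bounds the probability of rejection from below, and \<open>measure\<close> is 0
  off the sigma-algebra, so the rejection set must be shown to be an event. Majorants are infima
  over uncountable families; this is why they are rewritten below through rational slopes and
  rational points.\<close>

lemma maj_le:
  assumes "bounded (h ` {0..})" "concave_on {0..} h" "\<And>y. 0 \<le> y \<Longrightarrow> \<theta> y \<le> h y" "0 \<le> x"
  shows "maj \<theta> x \<le> h x"
  unfolding maj_on_def
proof (rule cInf_lower)
  show "h x \<in> {g x |g. bounded (g ` {0..}) \<and> concave_on {0..} g \<and> (\<forall>y\<in>{0..}. \<theta> y \<le> g y)}"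
    using assms by auto
  show "bdd_below {g x |g. bounded (g ` {0..}) \<and> concave_on {0..} g \<and> (\<forall>y\<in>{0..}. \<theta> y \<le> g y)}"
    using assms(4) by (intro bdd_belowI[of _ "\<theta> x"]) auto
qed

text \<open>The bound \<open>K\<close> supplies a competitor, the constant function
  \<open>K\<close>; an infimum over an empty family would have no usable value.\<close>

lemma maj_greatest:
  assumes bnd: "\<And>y. 0 \<le> y \<Longrightarrow> \<theta> y \<le> K"
    and "\<And>h. bounded (h ` {0..}) \<Longrightarrow> concave_on {0..} h \<Longrightarrow> (\<And>y. 0 \<le> y \<Longrightarrow> \<theta> y \<le> h y) \<Longrightarrow> c \<le> h x"
  shows "c \<le> maj \<theta> x"
  unfolding maj_on_def
proof (rule cInf_greatest)
  have "bounded ((\<lambda>_. K) ` {0::real..}) \<and> concave_on {0..} (\<lambda>_::real. K) \<and> (\<forall>y\<in>{0..}. \<theta> y \<le> K)"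
    using bnd by (auto simp: concave_on_const image_constant_conv)
  then show "{g x |g. bounded (g ` {0..}) \<and> concave_on {0..} g \<and> (\<forall>y\<in>{0..}. \<theta> y \<le> g y)} \<noteq> {}"
    by blast
qed (use assms(2) in auto)

lemma le_maj:
  assumes "\<And>y. 0 \<le> y \<Longrightarrow> \<theta> y \<le> K" "0 \<le> x"
  shows "\<theta> x \<le> maj \<theta> x"
  by (rule maj_greatest[where K = K]) (use assms in auto)

lemma maj_le_const:
  assumes "\<And>y. 0 \<le> y \<Longrightarrow> \<theta> y \<le> K" "0 \<le> x"
  shows "maj \<theta> x \<le> K"
  using maj_le[of "\<lambda>_. K" \<theta> x] assms by (auto simp: concave_on_const image_constant_conv)

lemma concave_on_maj:
  assumes "\<And>y. 0 \<le> y \<Longrightarrow> \<theta> y \<le> K"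
  shows "concave_on {0..} (maj \<theta>)"
  unfolding concave_on_iff
proof (intro conjI ballI allI impI)
  fix x y u v :: real
  assume xy: "x \<in> {0..}" "y \<in> {0..}" and uv: "0 \<le> u" "0 \<le> v" "u + v = 1"
  show "u * maj \<theta> x + v * maj \<theta> y \<le> maj \<theta> (u *\<^sub>R x + v *\<^sub>R y)"
  proof (rule maj_greatest[where K = K])
    fix h :: "real \<Rightarrow> real"
    assume h: "bounded (h ` {0..})" "concave_on {0..} h" "\<And>y. 0 \<le> y \<Longrightarrow> \<theta> y \<le> h y"
    have "u * maj \<theta> x + v * maj \<theta> y \<le> u * h x + v * h y"
      using maj_le[OF h] xy uv by (intro add_mono mult_left_mono) auto
    also have "\<dots> \<le> h (u *\<^sub>R x + v *\<^sub>R y)"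
      using h(2) xy uv unfolding concave_on_iff by blast
    finally show "u * maj \<theta> x + v * maj \<theta> y \<le> h (u *\<^sub>R x + v *\<^sub>R y)" .
  qed (use assms in auto)
qed auto

text \<open>Adding \<open>d\<close> to a competitor for \<open>\<theta>\<^sub>2\<close> gives a
  competitor for \<open>\<theta>\<^sub>1\<close>. Used in both directions, this is the sup-norm
  contraction property.\<close>

lemma maj_le_maj_add:
  assumes K: "\<And>y. 0 \<le> y \<Longrightarrow> \<theta>\<^sub>2 y \<le> K"
    and le: "\<And>y. 0 \<le> y \<Longrightarrow> \<theta>\<^sub>1 y \<le> \<theta>\<^sub>2 y + d" and x: "0 \<le> x"
  shows "maj \<theta>\<^sub>1 x \<le> maj \<theta>\<^sub>2 x + d"
proof -
  have "maj \<theta>\<^sub>1 x - d \<le> maj \<theta>\<^sub>2 x"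
  proof (rule maj_greatest[where K = K])
    fix h :: "real \<Rightarrow> real"
    assume h: "bounded (h ` {0..})" "concave_on {0..} h" "\<And>y. 0 \<le> y \<Longrightarrow> \<theta>\<^sub>2 y \<le> h y"
    have "maj \<theta>\<^sub>1 x \<le> (\<lambda>y. h y + d) x"
    proof (rule maj_le)
      have "(\<lambda>y. h y + d) ` {0..} = (\<lambda>z. z + d) ` h ` {0..}" by auto
      then show "bounded ((\<lambda>y. h y + d) ` {0..})"
        using bounded_translation[OF h(1), of d] by (simp add: add.commute)
      show "concave_on {0..} (\<lambda>y. h y + d)"
        using h(2) by (intro concave_on_add) (auto simp: concave_on_const)
      show "\<theta>\<^sub>1 y \<le> h y + d" if "0 \<le> y" for y
        using le[OF that] h(3)[OF that] by simp
    qed (fact x)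
    then show "maj \<theta>\<^sub>1 x - d \<le> h x" by simp
  qed (use K in auto)
  then show ?thesis by simp
qed

lemma maj_dist_le:
  assumes "\<And>y. 0 \<le> y \<Longrightarrow> \<bar>\<theta>\<^sub>1 y\<bar> \<le> K" "\<And>y. 0 \<le> y \<Longrightarrow> \<bar>\<theta>\<^sub>1 y - \<theta>\<^sub>2 y\<bar> \<le> d" "0 \<le> x"
  shows "\<bar>maj \<theta>\<^sub>1 x - maj \<theta>\<^sub>2 x\<bar> \<le> d"
proof -
  have 1: "\<theta>\<^sub>1 y \<le> K" and 2: "\<theta>\<^sub>1 y \<le> \<theta>\<^sub>2 y + d" and 3: "\<theta>\<^sub>2 y \<le> \<theta>\<^sub>1 y + d" and 4: "\<theta>\<^sub>2 y \<le> K + d"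
    if "0 \<le> y" for y
    using assms(1,2)[OF that] by auto
  show ?thesis
    using maj_le_maj_add[of \<theta>\<^sub>2 "K + d" \<theta>\<^sub>1 d x] maj_le_maj_add[of \<theta>\<^sub>1 K \<theta>\<^sub>2 d x] 1 2 3 4 assms(3)
    by fastforce
qed

lemma concave_on_min:
  fixes f g :: "'a::real_vector \<Rightarrow> real"
  assumes "concave_on S f" "concave_on S g"
  shows "concave_on S (\<lambda>x. min (f x) (g x))"
  unfolding concave_on_iff
proof (intro conjI ballI allI impI)
  show "convex S" using assms(1) by (simp add: concave_on_imp_convex)
  fix x y and u v :: real
  assume *: "x \<in> S" "y \<in> S" "0 \<le> u" "0 \<le> v" "u + v = 1"
  have "u * f x + v * f y \<le> f (u *\<^sub>R x + v *\<^sub>R y)" "u * g x + v * g y \<le> g (u *\<^sub>R x + v *\<^sub>R y)"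
    using assms * unfolding concave_on_iff by blast+
  moreover have "u * min (f x) (g x) + v * min (f y) (g y) \<le> u * f x + v * f y"
    "u * min (f x) (g x) + v * min (f y) (g y) \<le> u * g x + v * g y"
    using * by (intro add_mono mult_left_mono; simp)+
  ultimately show "u * min (f x) (g x) + v * min (f y) (g y)
      \<le> min (f (u *\<^sub>R x + v *\<^sub>R y)) (g (u *\<^sub>R x + v *\<^sub>R y))"
    by simp
qed

lemma maj_le_line:
  assumes K: "\<And>y. 0 \<le> y \<Longrightarrow> \<theta> y \<le> K" and s: "0 \<le> s" and x: "0 \<le> x"
    and le: "\<And>z. 0 \<le> z \<Longrightarrow> \<theta> z + s * (x - z) \<le> a"
  shows "maj \<theta> x \<le> a"
proof -
  \<comment> \<open>A nonconstant line is unbounded and hence no competitor. Capping it at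
    \<open>K\<close> preserves concavity and domination, and \<open>0 \<le> s\<close> bounds it
    below on the half-line.\<close>
  define h where "h = (\<lambda>z::real. min (a + s * (z - x)) K)"
  have "maj \<theta> x \<le> h x"
  proof (rule maj_le)
    have "s * z \<ge> 0" if "0 \<le> z" for z using s that by simp
    then have "min (a - s * x) K \<le> h z \<and> h z \<le> K" if "0 \<le> z" for z
      using that by (force simp: h_def algebra_simps min_def)
    then have "h ` {0..} \<subseteq> {min (a - s * x) K..K}" by auto
    then show "bounded (h ` {0..})" using bounded_closed_interval bounded_subset by blast
    have "concave_on {0..} (\<lambda>z. a + s * (z - x))"
      unfolding concave_on_iff
    proof (intro conjI ballI allI impI)
      fix y z u v :: real assume "u + v = 1"
      then have v: "v = 1 - u" by simp
      show "u * (a + s * (y - x)) + v * (a + s * (z - x)) \<le> a + s * (u *\<^sub>R y + v *\<^sub>R z - x)"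
        unfolding v by (simp add: algebra_simps)
    qed auto
    then show "concave_on {0..} h"
      unfolding h_def by (intro concave_on_min) (auto simp: concave_on_const)
    show "\<theta> z \<le> h z" if "0 \<le> z" for z
      using K[OF that] le[OF that] by (auto simp: h_def algebra_simps)
  qed (fact x)
  then show ?thesis by (simp add: h_def)
qed

text \<open>The endpoint 0 is an extreme point of the half-line, so a concave function may drop
  there: the constant \<open>K\<close> lowered to \<open>\<theta> 0\<close> at this single point is
  still a competitor.\<close>

lemma maj_zero:
  assumes K: "\<And>y. 0 \<le> y \<Longrightarrow> \<theta> y \<le> K"
  shows "maj \<theta> 0 = \<theta> 0"
proof (rule antisym)
  define h where "h = (\<lambda>z::real. if z = 0 then \<theta> 0 else K)"
  have "maj \<theta> 0 \<le> h 0"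
  proof (rule maj_le)
    have "h ` {0..} \<subseteq> {\<theta> 0, K}" by (auto simp: h_def)
    then show "bounded (h ` {0..})" using finite_imp_bounded finite_subset by blast
    show "concave_on {0..} h"
      unfolding concave_on_iff
    proof (intro conjI ballI allI impI)
      fix y z u v :: real
      assume *: "y \<in> {0..}" "z \<in> {0..}" "0 \<le> u" "0 \<le> v" "u + v = 1"
      have le: "h y \<le> K" "h z \<le> K" using K[of 0] by (auto simp: h_def)
      show "u * h y + v * h z \<le> h (u *\<^sub>R y + v *\<^sub>R z)"
      proof (cases "u *\<^sub>R y + v *\<^sub>R z = 0")
        case True
        then have "u * y = 0" "v * z = 0"
          using * by (auto simp: add_nonneg_eq_0_iff)
        then have "u * h y = u * \<theta> 0" "v * h z = v * \<theta> 0" by (auto simp: h_def)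
        then have "u * h y + v * h z = (u + v) * \<theta> 0" by (simp only: distrib_right)
        then show ?thesis using True * by (simp add: h_def)
      next
        case False
        have "u * h y + v * h z \<le> u * K + v * K" using * le by (intro add_mono mult_left_mono)
        also have "\<dots> = K" using * by (simp flip: distrib_right)
        finally show ?thesis using False by (simp add: h_def)
      qed
    qed auto
    show "\<theta> y \<le> h y" if "0 \<le> y" for y using K[OF that] by (auto simp: h_def)
  qed simp
  then show "maj \<theta> 0 \<le> \<theta> 0" by (simp add: h_def)
  show "\<theta> 0 \<le> maj \<theta> 0" by (rule le_maj[where K = K]) (use K in auto)
qed

lemma concave_supporting_line:
  fixes h :: "real \<Rightarrow> real"
  assumes conc: "concave_on {0..} h" and low: "\<And>y. 0 \<le> y \<Longrightarrow> L \<le> h y" and x: "0 < x"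
  obtains s where "0 \<le> s" "\<And>z. 0 \<le> z \<Longrightarrow> h z \<le> h x + s * (z - x)"
proof -
  \<comment> \<open>The right derivative of the convex function \<open>- h\<close> at
    \<open>x\<close>, with its sign reversed.\<close>
  define s where "s = - Inf ((\<lambda>t. (- h x - - h t) / (x - t)) ` ({x<..} \<inter> {0..}))"
  have line: "h z \<le> h x + s * (z - x)" if "0 \<le> z" for z
    using convex_le_Inf_differential[of "{0..}" "\<lambda>y. - h y" x z] conc x that
    by (simp add: concave_on_def s_def interior_real_atLeast)
  have "0 \<le> s"
  proof (rule ccontr)
    assume "\<not> 0 \<le> s"
    then have s: "s < 0" by simp
    \<comment> \<open>Here a line of negative slope \<open>s\<close> has fallen to
      \<open>- \<bar>L\<bar> - 1\<close> or lower, beneath the lower bound \<open>L\<close> of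
      \<open>h\<close>.\<close>
    define z where "z = x + (\<bar>h x\<bar> + \<bar>L\<bar> + 1) / (- s)"
    have "(\<bar>h x\<bar> + \<bar>L\<bar> + 1) / (- s) \<ge> 0" using s by (intro divide_nonneg_pos) auto
    then have z: "0 \<le> z" using x by (simp add: z_def)
    have "s * (z - x) = - (\<bar>h x\<bar> + \<bar>L\<bar> + 1)" using s by (simp add: z_def)
    then show False using line[OF z] low[OF z] by linarith
  qed
  then show ?thesis using that line by blast
qed

lemma rat_right_approx:
  fixes P :: "real \<Rightarrow> bool"
  assumes "eventually P (at_right z)"
  obtains q where "q \<in> \<rat>" "z < q" "P q"
proof -
  obtain b where b: "b > z" "\<And>y. z < y \<Longrightarrow> y < b \<Longrightarrow> P y"
    using assms unfolding eventually_at_right_field by blast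
  then show ?thesis using Rats_dense_in_real[OF b(1)] that by blast
qed

text \<open>Conjugate duality: the inner supremum is the height at \<open>x\<close> of the lowest
  line of slope \<open>s\<close> above \<theta>, and supporting lines show that lines suffice.
  Positive slopes are enough because competitors are bounded below; rational \<open>z\<close> are
  enough by right continuity, rational \<open>s\<close> by perturbation. The index sets are
  countable, which is what measurability requires.\<close>

lemma maj_eq_INF_SUP:
  assumes K: "\<And>y. 0 \<le> y \<Longrightarrow> \<bar>\<theta> y\<bar> \<le> K"
    and rc: "\<And>y. 0 \<le> y \<Longrightarrow> continuous (at_right y) \<theta>" and x: "0 < x"
  shows "maj \<theta> x = (INF s\<in>\<rat> \<inter> {0<..}. SUP z\<in>\<rat> \<inter> {0..}. \<theta> z + s * (x - z))" (is "_ = ?R")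
proof -
  define S where "S s = (SUP z\<in>\<rat> \<inter> {0..}. \<theta> z + s * (x - z))" for s
  have bdd: "bdd_above ((\<lambda>z. \<theta> z + s * (x - z)) ` (\<rat> \<inter> {0..}))" if "0 \<le> s" for s
  proof (rule bdd_aboveI2)
    fix z :: real assume "z \<in> \<rat> \<inter> {0..}"
    then have "\<theta> z \<le> K" "s * (x - z) \<le> s * x" using K[of z] that by (auto intro: mult_left_mono)
    then show "\<theta> z + s * (x - z) \<le> K + s * x" by simp
  qed
  have S_upper: "\<theta> z + s * (x - z) \<le> S s" if "0 \<le> s" "0 \<le> z" for s z
  proof (rule ccontr)
    assume "\<not> ?thesis"
    then have gt: "S s < \<theta> z + s * (x - z)" by simp
    have "continuous (at_right z) (\<lambda>y. \<theta> y + s * (x - y))"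
      using rc[OF that(2)] by (intro continuous_intros)
    then have "((\<lambda>y. \<theta> y + s * (x - y)) \<longlongrightarrow> \<theta> z + s * (x - z)) (at_right z)"
      by (simp add: continuous_within)
    then have "\<forall>\<^sub>F y in at_right z. S s < \<theta> y + s * (x - y)"
      using gt by (rule order_tendstoD)
    then obtain q where "q \<in> \<rat>" "z < q" and q: "S s < \<theta> q + s * (x - q)"
      using rat_right_approx by blast
    then have "\<theta> q + s * (x - q) \<le> S s"
      unfolding S_def using that by (intro cSUP_upper bdd) auto
    then show False using q by simp
  qed
  have S_ge: "\<theta> x \<le> S s" if "0 \<le> s" for s using S_upper[OF that, of x] x by simp
  have INF_le: "?R \<le> S s" if "s \<in> \<rat> \<inter> {0<..}" for s
    unfolding S_def[symmetric]
    by (rule cINF_lower[OF _ that]) (use S_ge in \<open>auto intro!: bdd_belowI2[of _ "\<theta> x"]\<close>)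
  show ?thesis
  proof (rule antisym)
    show "maj \<theta> x \<le> ?R"
    proof (rule cINF_greatest)
      have "(1::real) \<in> \<rat> \<inter> {0<..}" by auto
      then show "\<rat> \<inter> {0<..} \<noteq> ({} :: real set)" by blast
      fix s :: real assume s: "s \<in> \<rat> \<inter> {0<..}"
      show "maj \<theta> x \<le> (SUP z\<in>\<rat> \<inter> {0..}. \<theta> z + s * (x - z))"
        unfolding S_def[symmetric]
      proof (rule maj_le_line[where K = K and s = s])
        show "\<theta> y \<le> K" if "0 \<le> y" for y using K[OF that] by simp
      qed (use s x S_upper in auto)
    qed
    show "?R \<le> maj \<theta> x"
    proof (rule maj_greatest[where K = K])
      show "\<theta> y \<le> K" if "0 \<le> y" for y using K[OF that] by simp
      fix h :: "real \<Rightarrow> real"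
      assume h: "bounded (h ` {0..})" "concave_on {0..} h" "\<And>y. 0 \<le> y \<Longrightarrow> \<theta> y \<le> h y"
      have low: "- K \<le> h y" if "0 \<le> y" for y using h(3)[OF that] K[OF that] by auto
      obtain s where s: "0 \<le> s" "\<And>z. 0 \<le> z \<Longrightarrow> h z \<le> h x + s * (z - x)"
        using concave_supporting_line[OF h(2) low x] by auto
      show "?R \<le> h x"
      proof (rule field_le_epsilon)
        fix e :: real assume e: "0 < e"
        \<comment> \<open>Rounding the slope upwards keeps it positive and makes the error
          one-sided: \<open>(r - s) * (x - z)\<close> is at most \<open>(r - s) * x \<le> e\<close>,
          uniformly in \<open>z \<ge> 0\<close>.\<close>
        obtain r where r: "r \<in> \<rat>" "s < r" "r < s + e / x"
          using Rats_dense_in_real[of s "s + e / x"] e x by auto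
        have "?R \<le> S r" using r s by (intro INF_le) auto
        also have "S r \<le> h x + e"
          unfolding S_def
        proof (rule cSUP_least)
          fix z :: real assume "z \<in> \<rat> \<inter> {0..}"
          then have z: "0 \<le> z" by simp
          have "(r - s) * (x - z) \<le> (r - s) * x" using z r by (intro mult_left_mono) auto
          also have "\<dots> \<le> e / x * x" using r x by (intro mult_right_mono) auto
          finally have "(r - s) * (x - z) \<le> e" using x by simp
          then show "\<theta> z + r * (x - z) \<le> h x + e"
            using h(3)[OF z] s(2)[OF z] by (simp add: algebra_simps)
        qed (auto intro!: exI[of _ 0])
        finally show "?R \<le> h x + e" .
      qed
    qed
  qed
qed

lemma continuous_on_maj:
  assumes "\<And>y. 0 \<le> y \<Longrightarrow> \<theta> y \<le> K"
  shows "continuous_on {0<..} (maj \<theta>)"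
proof -
  have "convex_on {0<..} (\<lambda>x. - maj \<theta> x)"
    using concave_on_maj[OF assms] unfolding concave_on_def
    by (rule convex_on_subset) auto
  then have "continuous_on {0<..} (\<lambda>x. - (- maj \<theta> x))"
    by (intro continuous_on_minus convex_on_continuous) auto
  then show ?thesis by simp
qed

subsection \<open>Increments of the empirical process\<close>

text \<open>Reduces a moment generating function to the first two moments. For negative
  \<open>y\<close> the bound comes from \<open>exp y \<le> 1 / (1 - y)\<close> and
  \<open>(1 - y) * (1 + y + y\<^sup>2) = 1 - y ^ 3\<close>.\<close>

lemma exp_le_quadratic:
  fixes y :: real
  assumes "\<bar>y\<bar> \<le> 1"
  shows "exp y \<le> 1 + y + y\<^sup>2"
proof (cases "0 \<le> y")
  case True
  then show ?thesis using exp_bound[of y] assms by simp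
next
  case False
  have "1 - y \<le> exp (- y)" using exp_ge_add_one_self[of "- y"] by simp
  then have "inverse (exp (- y)) \<le> inverse (1 - y)"
    using False by (intro le_imp_inverse_le) auto
  then have "exp y \<le> inverse (1 - y)" by (simp add: exp_minus)
  also have "\<dots> \<le> 1 + y + y\<^sup>2"
  proof -
    have "(1 - y) * (1 + y + y\<^sup>2) = 1 - y ^ 3" by (simp add: algebra_simps power2_eq_square power3_eq_cube)
    moreover have "y ^ 3 \<le> 0" using False by (simp add: power3_eq_cube mult_nonneg_nonpos zero_le_mult_iff)
    ultimately have "1 \<le> (1 - y) * (1 + y + y\<^sup>2)" by simp
    then show ?thesis using False by (simp add: field_simps)
  qed
  finally show ?thesis .
qed

text \<open>A Bernstein-type exponent: the variance bound \<open>v\<close> stays visible, so that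
  increments of small mass get a small exponent. The range \<open>s \<le> 1\<close> keeps
  \<open>s * Y i\<close> where the quadratic bound on the exponential is valid.\<close>

lemma (in prob_space) chernoff_sum:
  fixes Y :: "'i \<Rightarrow> 'a \<Rightarrow> real"
  assumes indep: "indep_vars (\<lambda>_. borel) Y I" and fin: "finite I"
    and bnd: "\<And>i \<omega>. i \<in> I \<Longrightarrow> \<omega> \<in> space M \<Longrightarrow> \<bar>Y i \<omega>\<bar> \<le> 1"
    and mean: "\<And>i. i \<in> I \<Longrightarrow> expectation (Y i) = 0"
    and var: "\<And>i. i \<in> I \<Longrightarrow> expectation (\<lambda>\<omega>. (Y i \<omega>)\<^sup>2) \<le> v"
    and s: "0 \<le> s" "s \<le> 1"
  shows "prob {\<omega> \<in> space M. a \<le> (\<Sum>i\<in>I. Y i \<omega>)} \<le> exp (real (card I) * (s\<^sup>2 * v) - s * a)"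
proof -
  have rv [measurable]: "random_variable borel (Y i)" if "i \<in> I" for i
    using indep that by (auto simp: indep_vars_def)
  have int_exp: "integrable M (\<lambda>\<omega>. exp (s * Y i \<omega>))" if i: "i \<in> I" for i
  proof (rule integrable_const_bound[of _ "exp 1"])
    show "AE \<omega> in M. norm (exp (s * Y i \<omega>)) \<le> exp 1"
    proof (rule AE_I2)
      fix \<omega> assume "\<omega> \<in> space M"
      then have "\<bar>Y i \<omega>\<bar> \<le> 1" using bnd i by simp
      then have "\<bar>s * Y i \<omega>\<bar> \<le> 1" using s by (simp add: abs_mult mult_le_one)
      then show "norm (exp (s * Y i \<omega>)) \<le> exp 1" by auto
    qed
  qed (use rv[OF i] in measurable)
  have int1: "integrable M (Y i)" if i: "i \<in> I" for i
    by (rule integrable_const_bound[of _ 1]) (use rv[OF i] bnd[OF i] in auto)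
  have int2: "integrable M (\<lambda>\<omega>. (Y i \<omega>)\<^sup>2)" if i: "i \<in> I" for i
    by (rule integrable_const_bound[of _ 1]) (use rv[OF i] bnd[OF i] in \<open>auto simp: abs_square_le_1\<close>)
  have mgf: "expectation (\<lambda>\<omega>. exp (s * Y i \<omega>)) \<le> exp (s\<^sup>2 * v)" if i: "i \<in> I" for i
  proof -
    have "expectation (\<lambda>\<omega>. exp (s * Y i \<omega>)) \<le> expectation (\<lambda>\<omega>. 1 + s * Y i \<omega> + s\<^sup>2 * (Y i \<omega>)\<^sup>2)"
    proof (rule integral_mono[OF int_exp[OF i]])
      show "integrable M (\<lambda>\<omega>. 1 + s * Y i \<omega> + s\<^sup>2 * (Y i \<omega>)\<^sup>2)" using int1[OF i] int2[OF i] by simp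
      fix \<omega> assume "\<omega> \<in> space M"
      then have "\<bar>s * Y i \<omega>\<bar> \<le> 1" using s bnd[OF i] by (simp add: abs_mult mult_le_one)
      from exp_le_quadratic[OF this]
      show "exp (s * Y i \<omega>) \<le> 1 + s * Y i \<omega> + s\<^sup>2 * (Y i \<omega>)\<^sup>2" by (simp add: power_mult_distrib)
    qed
    also have "\<dots> = 1 + s\<^sup>2 * expectation (\<lambda>\<omega>. (Y i \<omega>)\<^sup>2)"
      using int1[OF i] int2[OF i] mean[OF i] by (simp add: prob_space)
    also have "\<dots> \<le> 1 + s\<^sup>2 * v" using var[OF i] by (simp add: mult_left_mono)
    also have "\<dots> \<le> exp (s\<^sup>2 * v)" by (rule exp_ge_add_one_self)
    finally show ?thesis .
  qed
  have indep_exp: "indep_vars (\<lambda>_. borel) (\<lambda>i \<omega>. exp (s * Y i \<omega>)) I"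
    using indep by (rule indep_vars_compose2) simp
  have int: "integrable M (\<lambda>\<omega>. \<Prod>i\<in>I. exp (s * Y i \<omega>))"
    using fin indep_exp int_exp by (rule indep_vars_integrable)
  have "prob {\<omega> \<in> space M. a \<le> (\<Sum>i\<in>I. Y i \<omega>)}
      \<le> prob {\<omega> \<in> space M. exp (s * a) \<le> (\<Prod>i\<in>I. exp (s * Y i \<omega>))}"
  proof (rule finite_measure_mono)
    show "{\<omega> \<in> space M. a \<le> (\<Sum>i\<in>I. Y i \<omega>)}
        \<subseteq> {\<omega> \<in> space M. exp (s * a) \<le> (\<Prod>i\<in>I. exp (s * Y i \<omega>))}"
      using fin s by (auto simp: mult_left_mono simp flip: exp_sum sum_distrib_left)
    show "{\<omega> \<in> space M. exp (s * a) \<le> (\<Prod>i\<in>I. exp (s * Y i \<omega>))} \<in> events"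
      using int by measurable
  qed
  also have "\<dots> \<le> expectation (\<lambda>\<omega>. \<Prod>i\<in>I. exp (s * Y i \<omega>)) / exp (s * a)"
    by (rule integral_Markov_inequality_measure[OF int, of "{}"]) (auto intro!: prod_nonneg)
  also have "expectation (\<lambda>\<omega>. \<Prod>i\<in>I. exp (s * Y i \<omega>)) = (\<Prod>i\<in>I. expectation (\<lambda>\<omega>. exp (s * Y i \<omega>)))"
    using fin indep_exp int_exp by (rule indep_vars_lebesgue_integral)
  also have "\<dots> / exp (s * a) \<le> (\<Prod>i\<in>I. exp (s\<^sup>2 * v)) / exp (s * a)"
    by (intro divide_right_mono prod_mono conjI mgf integral_nonneg_AE) auto
  also have "\<dots> = exp (real (card I) * (s\<^sup>2 * v) - s * a)"
    by (simp add: exp_diff exp_of_nat_mult)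
  finally show ?thesis .
qed

text \<open>Indexed by sets rather than thresholds, so that a grid of levels can include the empty
  set and the whole line for the levels 0 and 1.\<close>

definition freq :: "nat \<Rightarrow> (nat \<Rightarrow> 'b) \<Rightarrow> 'b set \<Rightarrow> real" where
  "freq n x S = (\<Sum>k<n. indicator S (x k)) / real n"

lemma freq_mono: "S \<subseteq> T \<Longrightarrow> freq n x S \<le> freq n x T"
  unfolding freq_def by (intro divide_right_mono sum_mono) (auto simp: indicator_def)

lemma ecdf_eq_freq: "ecdf n x y = freq n x {..y}"
  by (simp add: ecdf_def freq_def)

text \<open>An increment of mass \<open>u\<close> has variance at most \<open>\<bar>u\<bar>\<close>,
  so the exponent per observation is
  \<open>s\<^sup>2 * \<bar>u\<bar> - s * (c * u\<^sup>2 + r)\<close>. The quadratic allowance bounds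
  this in \<open>u\<close>, which frees the result from \<open>i\<close> and
  \<open>j\<close>.\<close>

lemma (in prob_space) freq_grid_increment:
  fixes X :: "nat \<Rightarrow> 'a \<Rightarrow> real"
  assumes indep: "indep_vars (\<lambda>_. borel) X UNIV"
    and S: "\<And>i. i \<le> m \<Longrightarrow> S i \<in> sets borel" "\<And>i j. i \<le> j \<Longrightarrow> j \<le> m \<Longrightarrow> S i \<subseteq> S j"
    and S_prob: "\<And>i k. i \<le> m \<Longrightarrow> prob (X k -` S i \<inter> space M) = real i / real m"
    and pos: "0 < n" "0 < m" "0 < c" and s: "0 \<le> s" "s \<le> 1" and ij: "i \<le> m" "j \<le> m"
  shows "prob {\<omega> \<in> space M. c * ((real j - real i) / real m)\<^sup>2 + r
      \<le> (freq n (\<lambda>k. X k \<omega>) (S j) - real j / real m) - (freq n (\<lambda>k. X k \<omega>) (S i) - real i / real m)}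
    \<le> exp (real n * (s ^ 3 / (4 * c) - s * r))"
proof -
  define u where "u = (real j - real i) / real m"
  define Z where "Z = (\<lambda>x. indicator (S j) x - indicator (S i) x :: real)"
  define Y where "Y = (\<lambda>k \<omega>. Z (X k \<omega>) - u)"
  \<comment> \<open>The direction of the increment. \<open>Z\<close> takes only the values 0 and
    \<sigma>, so \<open>Z * Z = \<sigma> * Z\<close>, and one variance computation serves both
    orders of \<open>i\<close> and \<open>j\<close>.\<close>
  define \<sigma> :: real where "\<sigma> = (if i \<le> j then 1 else -1)"
  have rv [measurable]: "random_variable borel (X k)" for k
    using indep by (auto simp: indep_vars_def)
  have Sm [measurable]: "S i \<in> sets borel" "S j \<in> sets borel" using S(1) ij by auto
  have sub: "i \<le> j \<Longrightarrow> S i \<subseteq> S j" "\<not> i \<le> j \<Longrightarrow> S j \<subseteq> S i" using S(2) ij by auto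
  have Z_cases: "Z x = 0 \<or> Z x = \<sigma>" for x
    using sub by (auto simp: Z_def \<sigma>_def indicator_def)
  have \<sigma>u: "\<sigma> * u = \<bar>u\<bar>"
    by (cases "i \<le> j") (auto simp: \<sigma>_def u_def divide_nonpos_nonneg)
  have u1: "\<bar>u\<bar> \<le> 1" using pos ij by (auto simp: u_def abs_le_iff divide_simps)
  have Zm: "Z \<in> borel_measurable borel" unfolding Z_def by measurable
  have intI: "integrable M (\<lambda>\<omega>. indicator (S l) (X k \<omega>) :: real)" if "l \<in> {i, j}" for k l
    by (rule integrable_const_bound[of _ 1]) (use that in \<open>auto simp: indicator_def\<close>)
  have EI: "expectation (\<lambda>\<omega>. indicator (S l) (X k \<omega>)) = real l / real m" if "l \<in> {i, j}" for k l
  proof -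
    have "expectation (\<lambda>\<omega>. indicator (S l) (X k \<omega>)) = expectation (indicator (X k -` S l \<inter> space M))"
      by (rule Bochner_Integration.integral_cong) (auto simp: indicator_def)
    also have "\<dots> = prob (X k -` S l \<inter> space M)" using that by auto
    finally show ?thesis using S_prob that ij by auto
  qed
  have intZ: "integrable M (\<lambda>\<omega>. Z (X k \<omega>))" for k using intI by (simp add: Z_def)
  have EZ: "expectation (\<lambda>\<omega>. Z (X k \<omega>)) = u" for k
    using intI EI by (simp add: Z_def u_def diff_divide_distrib)
  have mean: "expectation (Y k) = 0" for k
    unfolding Y_def using intZ EZ by (simp add: prob_space)
  have var: "expectation (\<lambda>\<omega>. (Y k \<omega>)\<^sup>2) \<le> \<bar>u\<bar>" for k
  proof -
    have "(Y k \<omega>)\<^sup>2 = (\<sigma> - 2 * u) * Z (X k \<omega>) + u\<^sup>2" for \<omega>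
    proof -
      have "Z (X k \<omega>) * Z (X k \<omega>) = \<sigma> * Z (X k \<omega>)" using Z_cases[of "X k \<omega>"] by auto
      then show ?thesis unfolding Y_def power2_eq_square by (simp add: algebra_simps)
    qed
    then have "expectation (\<lambda>\<omega>. (Y k \<omega>)\<^sup>2) = (\<sigma> - 2 * u) * u + u\<^sup>2"
      using intZ EZ by (simp add: prob_space)
    also have "\<dots> = \<bar>u\<bar> - u\<^sup>2" unfolding \<sigma>u[symmetric] by (simp add: algebra_simps power2_eq_square)
    finally show ?thesis by simp
  qed
  have bnd: "\<bar>Y k \<omega>\<bar> \<le> 1" for k \<omega>
  proof -
    have "\<bar>Y k \<omega>\<bar> = \<bar>\<sigma> * Z (X k \<omega>) - \<sigma> * u\<bar>" by (auto simp: Y_def \<sigma>_def)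
    moreover have "\<sigma> * Z (X k \<omega>) \<in> {0, 1}" using Z_cases[of "X k \<omega>"] by (auto simp: \<sigma>_def)
    ultimately show ?thesis using \<sigma>u u1 by auto
  qed
  have indepY: "indep_vars (\<lambda>_. borel) Y {..<n}"
    unfolding Y_def using indep_vars_subset[OF indep, of "{..<n}"]
    by (rule indep_vars_compose2) (use Zm in auto)
  have "prob {\<omega> \<in> space M. real n * (c * u\<^sup>2 + r) \<le> (\<Sum>k<n. Y k \<omega>)}
      \<le> exp (real (card {..<n}) * (s\<^sup>2 * \<bar>u\<bar>) - s * (real n * (c * u\<^sup>2 + r)))"
    by (rule chernoff_sum[OF indepY _ bnd mean var s]) auto
  also have "\<dots> \<le> exp (real n * (s ^ 3 / (4 * c) - s * r))"
  proof -
    \<comment> \<open>The maximum of \<open>s\<^sup>2 * w - s * (c * w\<^sup>2)\<close> over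
      \<open>w\<close> is \<open>s ^ 3 / (4 * c)\<close>, attained at
      \<open>w = s / (2 * c)\<close>; the square is the deficit from it.\<close>
    have complete_square: "s / (4 * c) * (2 * c * w - s)\<^sup>2 = s ^ 3 / (4 * c) - s\<^sup>2 * w + s * (c * w\<^sup>2)"
      for w
      using pos unfolding power2_eq_square power3_eq_cube by (simp add: field_simps)
    have "0 \<le> s / (4 * c) * (2 * c * \<bar>u\<bar> - s)\<^sup>2" using s pos by simp
    also have "\<dots> = s ^ 3 / (4 * c) - s\<^sup>2 * \<bar>u\<bar> + s * (c * u\<^sup>2)"
      by (simp only: complete_square power2_abs)
    finally have "s\<^sup>2 * \<bar>u\<bar> - s * (c * u\<^sup>2 + r) \<le> s ^ 3 / (4 * c) - s * r"
      unfolding distrib_left by linarith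
    then have "real n * (s\<^sup>2 * \<bar>u\<bar> - s * (c * u\<^sup>2 + r)) \<le> real n * (s ^ 3 / (4 * c) - s * r)"
      by (intro mult_left_mono) auto
    then show ?thesis by (simp add: right_diff_distrib mult.left_commute)
  qed
  also have "{\<omega> \<in> space M. real n * (c * u\<^sup>2 + r) \<le> (\<Sum>k<n. Y k \<omega>)}
    = {\<omega> \<in> space M. c * ((real j - real i) / real m)\<^sup>2 + r
      \<le> (freq n (\<lambda>k. X k \<omega>) (S j) - real j / real m) - (freq n (\<lambda>k. X k \<omega>) (S i) - real i / real m)}"
  proof -
    have "(freq n (\<lambda>k. X k \<omega>) (S j) - real j / real m) - (freq n (\<lambda>k. X k \<omega>) (S i) - real i / real m)
        = (\<Sum>k<n. Y k \<omega>) / real n" for \<omega>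
      using pos by (simp add: freq_def Y_def Z_def u_def sum_subtractf diff_divide_distrib add_divide_distrib)
    then show ?thesis using pos by (simp add: u_def[symmetric] pos_le_divide_eq mult.commute)
  qed
  finally show ?thesis .
qed

text \<open>The empirical distribution is monotone, so rounding \<open>z\<close> up and
  \<open>y\<close> down only enlarges the increment. Each rounding moves the level by at most
  \<open>2 / m\<close>.\<close>

lemma grid_modulus:
  fixes F :: "real \<Rightarrow> real"
  assumes grid: "\<And>i j. i \<le> m \<Longrightarrow> j \<le> m \<Longrightarrow>
      (freq n x (S j) - real j / real m) - (freq n x (S i) - real i / real m)
        \<le> c * ((real j - real i) / real m)\<^sup>2 + r"
    and bracket: "\<And>y. \<exists>l\<le>m. \<exists>h\<le>m. S l \<subseteq> {..y} \<and> {..y} \<subseteq> S h \<and>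
      F y - 2 / real m \<le> real l / real m \<and> real l / real m \<le> F y \<and>
      F y \<le> real h / real m \<and> real h / real m \<le> F y + 2 / real m"
    and F: "\<And>y. 0 \<le> F y" "\<And>y. F y \<le> 1"
    and pos: "0 < m" "0 \<le> c"
  shows "(ecdf n x z - F z) - (ecdf n x y - F y) \<le> c * (F z - F y)\<^sup>2 + r + (24 * c + 4) / real m"
proof -
  obtain h where h: "h \<le> m" "{..z} \<subseteq> S h" "F z \<le> real h / real m" "real h / real m \<le> F z + 2 / real m"
    using bracket[of z] by blast
  obtain l where l: "l \<le> m" "S l \<subseteq> {..y}" "F y - 2 / real m \<le> real l / real m" "real l / real m \<le> F y"
    using bracket[of y] by blast
  define u where "u = F z - F y"
  define d where "d = (real h - real l) / real m - u"
  have m: "0 < 1 / real m" "1 / real m \<le> 1" using pos by auto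
  have d: "0 \<le> d" "d \<le> 4 * (1 / real m)"
    using h(3,4) l(3,4) unfolding d_def u_def by (auto simp: diff_divide_distrib)
  have u: "\<bar>u\<bar> \<le> 1" using F[of z] F[of y] by (auto simp: u_def)
  have "(u + d)\<^sup>2 = u\<^sup>2 + (2 * u) * d + d * d" by (simp add: power2_eq_square algebra_simps)
  \<comment> \<open>From \<open>\<bar>u\<bar> \<le> 1\<close> and \<open>d \<le> 4\<close> the
    change of the square is at most \<open>6 * d\<close>; with \<open>d \<le> 4 / m\<close> this
    gives the constant 24.\<close>
  also have "\<dots> \<le> u\<^sup>2 + 2 * d + 4 * d"
  proof -
    have "d \<le> 4" using d m by linarith
    then show ?thesis using d u by (intro add_mono mult_right_mono) auto
  qed
  also have "\<dots> \<le> u\<^sup>2 + 24 / real m" using d by simp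
  finally have sq: "((real h - real l) / real m)\<^sup>2 \<le> u\<^sup>2 + 24 / real m" by (simp add: d_def)
  have "(ecdf n x z - F z) - (ecdf n x y - F y) \<le> (freq n x (S h) - F z) - (freq n x (S l) - F y)"
    using freq_mono[OF h(2), of n x] freq_mono[OF l(2), of n x] by (simp add: ecdf_eq_freq)
  also have "\<dots> \<le> (freq n x (S h) - real h / real m) - (freq n x (S l) - real l / real m) + 4 / real m"
    using h(4) l(3) by simp
  also have "\<dots> \<le> c * ((real h - real l) / real m)\<^sup>2 + r + 4 / real m" using grid[OF l(1) h(1)] by simp
  also have "\<dots> \<le> c * (u\<^sup>2 + 24 / real m) + r + 4 / real m" using sq pos by (simp add: mult_left_mono)
  also have "\<dots> = c * u\<^sup>2 + r + (24 * c + 4) / real m" by (simp add: algebra_simps add_divide_distrib)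
  finally show ?thesis by (simp add: u_def)
qed

lemma grid_brackets:
  fixes F :: "real \<Rightarrow> real"
  assumes m: "0 < m" and mono: "mono F" and F: "0 \<le> F y" "F y \<le> 1"
    and a: "\<And>i. 0 < i \<Longrightarrow> i < m \<Longrightarrow> F (a i) = real i / real m"
  defines "S \<equiv> \<lambda>i. if i = 0 then {} else if i < m then {..a i} else UNIV"
  shows "\<exists>l\<le>m. \<exists>h\<le>m. S l \<subseteq> {..y} \<and> {..y} \<subseteq> S h \<and>
      F y - 2 / real m \<le> real l / real m \<and> real l / real m \<le> F y \<and>
      F y \<le> real h / real m \<and> real h / real m \<le> F y + 2 / real m"
proof -
  define k where "k = nat \<lfloor>real m * F y\<rfloor>"
  have k: "real k \<le> real m * F y" "real m * F y < real k + 1"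
    using F m by (auto simp: k_def of_nat_nat)
  have km: "k \<le> m"
  proof -
    have "real k \<le> real m" using k(1) F m mult_left_le[of "F y" "real m"] by linarith
    then show ?thesis by simp
  qed
  have less: "p < q" if "F p < F q" for p q
    using that monoD[OF mono, of q p] by (cases "p < q") auto
  \<comment> \<open>One level lower than the floor. On a flat piece of \<open>F\<close> the point
    \<open>a k\<close> may lie to the right of \<open>y\<close> although
    \<open>F (a k) = F y\<close>; at level \<open>l\<close> the inequality
    \<open>F (a l) < F y\<close> is strict, so monotonicity places \<open>a l\<close> left of
    \<open>y\<close>. For \<open>k = 0\<close> truncated subtraction gives \<open>l = 0\<close>, the
    empty set.\<close>
  define l where "l = k - 1"
  have l: "l \<le> m" "S l \<subseteq> {..y}" "F y - 2 / real m \<le> real l / real m" "real l / real m \<le> F y"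
  proof -
    show "l \<le> m" using km by (simp add: l_def)
    have lk: "real l \<le> real k" "real k \<le> real l + 1" by (auto simp: l_def)
    have "(real m * F y - 2) / real m \<le> real l / real m"
      using k lk by (intro divide_right_mono) auto
    then show "F y - 2 / real m \<le> real l / real m"
      using m by (simp add: diff_divide_distrib)
    show "real l / real m \<le> F y"
      using k lk m by (simp add: pos_divide_le_eq mult.commute)
    show "S l \<subseteq> {..y}"
    proof (cases "l = 0")
      case False
      then have "l < k" "l < m" "0 < l" using km by (auto simp: l_def)
      have "real l / real m < F y"
        using \<open>l < k\<close> k m by (simp add: pos_divide_less_eq mult.commute)
      then have "F (a l) < F y" using a[of l] \<open>0 < l\<close> \<open>l < m\<close> by simp
      from less[OF this] show ?thesis using \<open>l < m\<close> by (auto simp: S_def)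
    qed (simp add: S_def)
  qed
  \<comment> \<open>Again a strict inequality, \<open>F y < F (a h)\<close>; the level
    \<open>m\<close> stands for the whole line.\<close>
  define h where "h = min m (k + 1)"
  have h: "h \<le> m" "{..y} \<subseteq> S h" "F y \<le> real h / real m" "real h / real m \<le> F y + 2 / real m"
  proof -
    show "h \<le> m" by (simp add: h_def)
    have "real m * F y \<le> real h" using k F m mult_left_le[of "F y" "real m"] by (auto simp: h_def min_def)
    moreover have "real h \<le> real m * F y + 2" using k by (auto simp: h_def min_def)
    ultimately have "real h / real m \<le> (real m * F y + 2) / real m" "F y \<le> real h / real m"
      using m by (auto intro!: divide_right_mono simp: pos_le_divide_eq mult.commute)
    then show "F y \<le> real h / real m" "real h / real m \<le> F y + 2 / real m"
      using m by (simp_all add: add_divide_distrib)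
    show "{..y} \<subseteq> S h"
    proof (cases "h < m")
      case True
      then have h: "h = k + 1" by (simp add: h_def)
      have "F y < real h / real m" using k m by (simp add: h pos_less_divide_eq mult.commute)
      then have "F y < F (a h)" using a[of h] True h by simp
      from less[OF this] show ?thesis using True h by (auto simp: S_def)
    qed (use m in \<open>auto simp: S_def h_def\<close>)
  qed
  show ?thesis using l h by blast
qed

text \<open>A union bound over the pairs of a grid with \<open>n\<close> levels, refined to all
  \<open>y\<close> and \<open>z\<close> by bracketing. The grid error is of order
  \<open>1 / n\<close> and disappears in the main term.\<close>

lemma (in prob_space) modulus_event:
  fixes X :: "nat \<Rightarrow> 'a \<Rightarrow> real" and F :: "real \<Rightarrow> real"
  assumes indep: "indep_vars (\<lambda>_. borel) X UNIV"
    and X_cdf: "\<And>i. cdf (distr M borel (X i)) = F"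
    and onto: "\<And>q. 0 < q \<Longrightarrow> q < 1 \<Longrightarrow> \<exists>a. F a = q"
    and c: "0 < c"
  obtains A E where "\<And>n. E n \<in> events" "(\<lambda>n. prob (E n)) \<longlonglongrightarrow> 1"
    "\<And>n \<omega> y z. 3 \<le> n \<Longrightarrow> \<omega> \<in> E n \<Longrightarrow>
      (ecdf n (\<lambda>i. X i \<omega>) z - F z) - (ecdf n (\<lambda>i. X i \<omega>) y - F y)
        \<le> c * (F z - F y)\<^sup>2 + A * (ln (real n) / real n) powr (2/3)"
proof -
  have rv [measurable]: "random_variable borel (X k)" for k
    using indep by (auto simp: indep_vars_def)
  have F_prob: "F y = prob (X k -` {..y} \<inter> space M)" for k y
  proof -
    have "F y = measure (distr M borel (X k)) {..y}" using X_cdf[of k] by (auto simp: cdf_def)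
    then show ?thesis by (simp add: measure_distr)
  qed
  have F01: "0 \<le> F y" "F y \<le> 1" for y using F_prob[of y 0] by auto
  have mono: "mono F"
  proof (rule monoI)
    fix x y :: real assume "x \<le> y"
    then show "F x \<le> F y" unfolding F_prob[of _ 0] by (intro finite_measure_mono) auto
  qed
  obtain a where a: "\<And>q. 0 < q \<Longrightarrow> q < 1 \<Longrightarrow> F (a q) = q" using onto by metis
  define S where "S n i = (if i = 0 then {} else if i < n then {..a (real i / real n)} else UNIV)"
    for n i :: nat
  have aF: "F (a (real i / real n)) = real i / real n" if "0 < i" "i < n" for i n
    using that by (intro a) auto
  have Sm: "S n i \<in> sets borel" for n i by (simp add: S_def)
  have S_mono: "S n i \<subseteq> S n j" if "i \<le> j" "j \<le> n" for n i j
  proof (cases "i = 0 \<or> j = n \<or> i = j")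
    case False
    then have ij: "0 < i" "i < j" "j < n" using that by auto
    then have "real i / real n < real j / real n" by (simp add: divide_strict_right_mono)
    then have "F (a (real i / real n)) < F (a (real j / real n))" using ij by (simp add: aF)
    then have "a (real i / real n) \<le> a (real j / real n)" using monoD[OF mono] by (meson linorder_not_less nle_le)
    then show ?thesis using ij by (auto simp: S_def)
  qed (use that in \<open>auto simp: S_def\<close>)
  have S_prob: "prob (X k -` S n i \<inter> space M) = real i / real n" if "i \<le> n" "0 < n" for n i k
  proof -
    have "prob (X k -` {..a (real i / real n)} \<inter> space M) = real i / real n" if "0 < i" "i < n"
      using aF[OF that] F_prob by metis
    moreover have "prob (X k -` UNIV \<inter> space M) = 1" by (simp add: prob_space)
    ultimately show ?thesis using that by (auto simp: S_def)
  qed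
  \<comment> \<open>Here \<open>s n ^ 3 = ln n / n\<close>, and the constant in \<open>r n\<close>
    is tuned so that \<open>n * (s n ^ 3 / (4 * c) - s n * r n) = - 4 * ln n\<close>. Each pair then
    fails with probability at most \<open>n\<close> to the power -4, while there are only
    \<open>(n + 1)\<^sup>2\<close> pairs.\<close>
  define s where "s n = (ln (real n) / real n) powr (1/3)" for n :: nat
  define r where "r n = (4 + 1 / (4 * c)) * (s n)\<^sup>2" for n
  define B where "B n i j = {\<omega> \<in> space M. c * ((real j - real i) / real n)\<^sup>2 + r n
      \<le> (freq n (\<lambda>k. X k \<omega>) (S n j) - real j / real n) - (freq n (\<lambda>k. X k \<omega>) (S n i) - real i / real n)}"
    for n i j
  define E where "E n = space M - (\<Union>i\<in>{..n}. \<Union>j\<in>{..n}. B n i j)" for n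
  have Bm: "B n i j \<in> events" for n i j
    using Sm[of n] unfolding B_def freq_def by measurable
  have Em: "E n \<in> events" for n using Bm unfolding E_def by auto
  have ratio: "0 \<le> ln (real n) / real n" "ln (real n) / real n \<le> 1" if "0 < n" for n
  proof -
    have "ln (real n) \<le> real n - 1" using that by (intro ln_le_minus_one) auto
    then show "ln (real n) / real n \<le> 1" using that by (simp add: divide_le_eq)
    show "0 \<le> ln (real n) / real n" using that by simp
  qed
  have B_prob: "prob (B n i j) \<le> exp (- 4 * ln (real n))" if n: "0 < n" and ij: "i \<le> n" "j \<le> n" for n i j
  proof -
    have s: "0 \<le> s n" "s n \<le> 1"
      using ratio[OF n] by (auto simp: s_def intro!: powr_le1)
    have cube: "s n ^ 3 = ln (real n) / real n"
      using ratio[OF n] by (cases "ln (real n) / real n = 0") (auto simp: s_def powr_power)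
    have "prob (B n i j) \<le> exp (real n * (s n ^ 3 / (4 * c) - s n * r n))"
      unfolding B_def
      by (rule freq_grid_increment[OF indep]) (use Sm S_mono S_prob n c s ij in auto)
    also have "real n * (s n ^ 3 / (4 * c) - s n * r n) = real n * (- 4 * s n ^ 3)"
      by (simp add: r_def power3_eq_cube power2_eq_square algebra_simps)
    also have "\<dots> = - 4 * ln (real n)" using n by (simp add: cube)
    finally show ?thesis .
  qed
  have E_prob: "1 - (real n + 1)\<^sup>2 * exp (- 4 * ln (real n)) \<le> prob (E n)" if n: "0 < n" for n
  proof -
    have "prob (\<Union>i\<in>{..n}. \<Union>j\<in>{..n}. B n i j) \<le> (\<Sum>i\<le>n. \<Sum>j\<le>n. prob (B n i j))"
      using Bm by (intro order.trans[OF finite_measure_subadditive_finite] sum_mono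
          finite_measure_subadditive_finite) auto
    also have "\<dots> \<le> (\<Sum>i\<le>n. \<Sum>j\<le>n. exp (- 4 * ln (real n)))"
      using B_prob[OF n] by (intro sum_mono) auto
    also have "\<dots> = (real n + 1)\<^sup>2 * exp (- 4 * ln (real n))" by (simp add: power2_eq_square algebra_simps)
    finally show ?thesis
      unfolding E_def using Bm by (subst prob_compl) auto
  qed
  have "(\<lambda>n. prob (E n)) \<longlonglongrightarrow> 1"
  proof (rule tendsto_sandwich)
    show "\<forall>\<^sub>F n in sequentially. 1 - (real n + 1)\<^sup>2 * exp (- 4 * ln (real n)) \<le> prob (E n)"
      using E_prob by (intro eventually_sequentiallyI[of 1]) auto
    show "(\<lambda>n. 1 - (real n + 1)\<^sup>2 * exp (- 4 * ln (real n))) \<longlonglongrightarrow> 1" by real_asymp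
  qed auto
  moreover have "(ecdf n (\<lambda>i. X i \<omega>) z - F z) - (ecdf n (\<lambda>i. X i \<omega>) y - F y)
        \<le> c * (F z - F y)\<^sup>2 + (4 + 1 / (4 * c) + (24 * c + 4)) * (ln (real n) / real n) powr (2/3)"
    if n: "3 \<le> n" and \<omega>: "\<omega> \<in> E n" for n \<omega> y z
  proof -
    have "(ecdf n (\<lambda>i. X i \<omega>) z - F z) - (ecdf n (\<lambda>i. X i \<omega>) y - F y)
        \<le> c * (F z - F y)\<^sup>2 + r n + (24 * c + 4) / real n"
    proof (rule grid_modulus[where S = "S n"])
      fix i j assume "i \<le> n" "j \<le> n"
      moreover have "\<omega> \<in> space M" using \<omega> by (simp add: E_def)
      ultimately have "\<not> (c * ((real j - real i) / real n)\<^sup>2 + r n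
        \<le> (freq n (\<lambda>k. X k \<omega>) (S n j) - real j / real n) - (freq n (\<lambda>k. X k \<omega>) (S n i) - real i / real n))"
        using \<omega> unfolding E_def B_def by blast
      then show "(freq n (\<lambda>k. X k \<omega>) (S n j) - real j / real n) - (freq n (\<lambda>k. X k \<omega>) (S n i) - real i / real n)
        \<le> c * ((real j - real i) / real n)\<^sup>2 + r n" by linarith
    next
      fix y
      show "\<exists>l\<le>n. \<exists>h\<le>n. S n l \<subseteq> {..y} \<and> {..y} \<subseteq> S n h \<and>
        F y - 2 / real n \<le> real l / real n \<and> real l / real n \<le> F y \<and>
        F y \<le> real h / real n \<and> real h / real n \<le> F y + 2 / real n"
        unfolding S_def by (rule grid_brackets) (use n mono F01 aF in auto)
    qed (use F01 n c in auto)
    also have "(s n)\<^sup>2 = (ln (real n) / real n) powr (2/3)"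
      using ratio[of n] n by (cases "ln (real n) / real n = 0") (auto simp: s_def powr_power)
    then have "r n = (4 + 1 / (4 * c)) * (ln (real n) / real n) powr (2/3)" by (simp add: r_def)
    also have "(24 * c + 4) / real n \<le> (24 * c + 4) * (ln (real n) / real n) powr (2/3)"
    proof -
      \<comment> \<open>The point of \<open>3 \<le> n\<close>: it exceeds \<open>exp 1\<close>, so
        \<open>1 / n \<le> ln n / n\<close>, and a ratio in the unit interval grows when its
        exponent drops from 1 to 2/3.\<close>
      have "1 \<le> ln (real n)" using n exp_le by (subst ln_ge_iff) auto
      then have "1 / real n \<le> (ln (real n) / real n) powr 1" using n by (simp add: divide_right_mono)
      also have "\<dots> \<le> (ln (real n) / real n) powr (2/3)"
        using ratio[of n] n \<open>1 \<le> ln (real n)\<close> by (intro powr_mono') auto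
      finally show ?thesis using c mult_left_mono[of "1 / real n" _ "24 * c + 4"] by simp
    qed
    finally show ?thesis by (simp add: algebra_simps)
  qed
  ultimately show ?thesis using Em that by blast
qed

section \<open>Uniform deviation of the multinomial bootstrap\<close>

text \<open>With the data fixed, the weights count independent uniform draws of indices, and the
  deviation at \<open>y\<close> depends on \<open>y\<close> only through the index set
  \<open>{i. i < n \<and> x i \<le> y}\<close>. There are at most \<open>n + 1\<close> such sets
  whatever the data, and two signs for each; hence the prefactor.\<close>

lemma multinomial_sup_bound:
  fixes x :: "nat \<Rightarrow> real"
  assumes n: "0 < n" and \<epsilon>: "0 < \<epsilon>" "\<epsilon> \<le> 2"
  shows "measure_pmf.prob (multinomial_weights n) {w. \<exists>y. \<bar>boot_ecdf n w x y - ecdf n x y\<bar> > \<epsilon>}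
    \<le> 2 * (real n + 1) * exp (- (real n * \<epsilon>\<^sup>2 / 4))"
proof -
  define D where "D = Pi_pmf {..<n} (0::nat) (\<lambda>_. pmf_of_set {..<n})"
  define Y where "Y A j d = indicator A (d j) - real (card A) / real n"
    for A :: "nat set" and j and d :: "nat \<Rightarrow> nat"
  \<comment> \<open>The nonempty index sets are listed by their largest observation; the empty one
    belongs to \<open>y\<close> below all data.\<close>
  define \<A> where "\<A> = insert {} ((\<lambda>k. {i. i < n \<and> x i \<le> x k}) ` {..<n})"
  have fin\<A>: "finite \<A>" by (simp add: \<A>_def)
  have card\<A>: "card \<A> \<le> n + 1"
  proof -
    have "card \<A> \<le> Suc (card ((\<lambda>k. {i. i < n \<and> x i \<le> x k}) ` {..<n}))"
      unfolding \<A>_def by (rule card_insert_le_m1) auto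
    also have "\<dots> \<le> Suc n" using card_image_le[of "{..<n}"] by simp
    finally show ?thesis by simp
  qed
  have \<A>_sub: "A \<subseteq> {..<n}" if "A \<in> \<A>" for A using that by (auto simp: \<A>_def)
  have \<A>_all: "{i. i < n \<and> x i \<le> y} \<in> \<A>" for y
  proof (cases "{i. i < n \<and> x i \<le> y} = {}")
    case False
    let ?I = "{i. i < n \<and> x i \<le> y}"
    have "Max (x ` ?I) \<in> x ` ?I" using False by (intro Max_in) auto
    then obtain k where k: "k \<in> ?I" "Max (x ` ?I) = x k" by auto
    have "x i \<le> x k" if "i \<in> ?I" for i
    proof -
      have "x i \<le> Max (x ` ?I)" by (rule Max_ge) (use that in auto)
      then show ?thesis using k by simp
    qed
    then have "?I = {i. i < n \<and> x i \<le> x k}" using k by force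
    then show ?thesis using k unfolding \<A>_def by blast
  qed (simp add: \<A>_def)
  have dev: "measure_pmf.prob D {d. real n * \<epsilon> \<le> (\<Sum>j<n. \<sigma> * Y A j d)} \<le> exp (- (real n * \<epsilon>\<^sup>2 / 4))"
    if A: "A \<in> \<A>" and \<sigma>: "\<bar>\<sigma>\<bar> = 1" for A and \<sigma> :: real
  proof -
    have cA: "card A \<le> n" using card_mono[OF _ \<A>_sub[OF A]] by simp
    have bnd: "\<bar>\<sigma> * Y A j d\<bar> \<le> 1" for j d
    proof -
      have "0 \<le> real (card A) / real n" "real (card A) / real n \<le> 1" using cA n by auto
      then have "\<bar>Y A j d\<bar> \<le> 1" by (auto simp: Y_def indicator_def)
      then show ?thesis using \<sigma> by (simp add: abs_mult)
    qed
    have "prob_space.indep_vars D (\<lambda>_. borel) (\<lambda>j d. \<sigma> * Y A j d) {..<n}"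
      unfolding Y_def D_def by (rule prob_space.indep_vars_compose2[OF _ indep_vars_Pi_pmf])
        (auto simp: prob_space_measure_pmf)
    moreover have "measure_pmf.expectation D (\<lambda>d. \<sigma> * Y A j d) = 0" if j: "j \<in> {..<n}" for j
    proof -
      have "measure_pmf.expectation D (\<lambda>d. indicator A (d j) :: real)
          = measure_pmf.expectation (map_pmf (\<lambda>d. d j) D) (indicator A)"
        by (rule integral_map_pmf[of "\<lambda>d. d j" D "indicator A :: nat \<Rightarrow> real", symmetric])
      also have "map_pmf (\<lambda>d. d j) D = pmf_of_set {..<n}" using j by (simp add: D_def Pi_pmf_component)
      also have "measure_pmf.expectation (pmf_of_set {..<n}) (indicator A) = real (card A) / real n"
        using n \<A>_sub[OF A] by (simp add: integral_pmf_of_set measure_pmf_of_set Int_absorb1 lessThan_empty_iff)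
      finally have "measure_pmf.expectation D (\<lambda>d. indicator A (d j)) = real (card A) / real n" .
      moreover have "integrable (measure_pmf D) (\<lambda>d. indicator A (d j) :: real)"
        by (rule measure_pmf.integrable_const_bound[of _ 1]) auto
      ultimately show ?thesis by (simp add: Y_def measure_pmf.prob_space)
    qed
    moreover have "measure_pmf.expectation D (\<lambda>d. (\<sigma> * Y A j d)\<^sup>2) \<le> 1" for j
    proof -
      have "measure_pmf.expectation D (\<lambda>d. (\<sigma> * Y A j d)\<^sup>2) \<le> measure_pmf.expectation D (\<lambda>d. 1)"
        using bnd by (intro integral_mono measure_pmf.integrable_const_bound[of _ 1]) (auto simp: abs_square_le_1)
      then show ?thesis by simp
    qed
    \<comment> \<open>Chernoff with the crude variance bound 1 and
      \<open>s = \<epsilon> / 2\<close>, which is at most 1 because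
      \<open>\<epsilon> \<le> 2\<close>.\<close>
    ultimately have "measure_pmf.prob D {d \<in> space (measure_pmf D). real n * \<epsilon> \<le> (\<Sum>j\<in>{..<n}. \<sigma> * Y A j d)}
      \<le> exp (real (card {..<n}) * ((\<epsilon> / 2)\<^sup>2 * 1) - \<epsilon> / 2 * (real n * \<epsilon>))"
      using bnd \<epsilon> by (intro measure_pmf.chernoff_sum) auto
    also have "real (card {..<n}) * ((\<epsilon> / 2)\<^sup>2 * 1) - \<epsilon> / 2 * (real n * \<epsilon>) = - (real n * \<epsilon>\<^sup>2 / 4)"
      by (simp add: power2_eq_square field_simps)
    finally show ?thesis by simp
  qed
  \<comment> \<open>Exchanging the sums turns dependent category counts into a sum over independent
    draws. It needs all draws to lie below \<open>n\<close>, which holds on the support of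
    \<open>D\<close>.\<close>
  have boot_diff: "boot_ecdf n (\<lambda>i. card {j. j < n \<and> d j = i}) x y - ecdf n x y
      = (\<Sum>j<n. Y {i. i < n \<and> x i \<le> y} j d) / real n" if d: "d \<in> set_pmf D" for d y
  proof -
    let ?A = "{i. i < n \<and> x i \<le> y}"
    have dn: "d j < n" if "j < n" for j
    proof -
      have "d \<in> PiE_dflt {..<n} 0 (set_pmf \<circ> (\<lambda>_. pmf_of_set {..<n}))"
        using d unfolding D_def by (simp only: set_Pi_pmf finite_lessThan)
      then have "d j \<in> set_pmf (pmf_of_set {..<n})" using that unfolding PiE_dflt_def by force
      moreover have "set_pmf (pmf_of_set {..<n}) = {..<n}" using n by (intro set_pmf_of_set) auto
      ultimately show ?thesis by simp
    qed
    have "(\<Sum>i<n. real (card {j. j < n \<and> d j = i}) * indicator {..y} (x i))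
        = (\<Sum>i<n. \<Sum>j<n. indicator {i} (d j) * indicator {..y} (x i))"
    proof (rule sum.cong[OF refl])
      fix i
      have "real (card {j. j < n \<and> d j = i}) = (\<Sum>j\<in>{j. j < n \<and> d j = i}. 1)" by simp
      also have "\<dots> = (\<Sum>j<n. indicator {i} (d j))"
        by (rule sum.mono_neutral_cong_left) (simp_all add: indicator_def subset_eq)
      finally show "real (card {j. j < n \<and> d j = i}) * indicator {..y} (x i)
        = (\<Sum>j<n. indicator {i} (d j) * indicator {..y} (x i))" by (simp only: sum_distrib_right)
    qed
    also have "\<dots> = (\<Sum>j<n. \<Sum>i<n. indicator {i} (d j) * indicator {..y} (x i))" by (rule sum.swap)
    also have "\<dots> = (\<Sum>j<n. indicator ?A (d j))"
    proof (rule sum.cong[OF refl])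
      fix j assume "j \<in> {..<n}"
      then have "(\<Sum>i<n. indicator {i} (d j) * indicator {..y} (x i) :: real)
          = (\<Sum>i\<in>{d j}. indicator {i} (d j) * indicator {..y} (x i))"
        using dn by (intro sum.mono_neutral_right) (auto simp: indicator_def)
      then show "(\<Sum>i<n. indicator {i} (d j) * indicator {..y} (x i) :: real) = indicator ?A (d j)"
        using dn \<open>j \<in> {..<n}\<close> by (auto simp: indicator_def)
    qed
    finally have boot: "boot_ecdf n (\<lambda>i. card {j. j < n \<and> d j = i}) x y
        = (\<Sum>j<n. indicator ?A (d j)) / real n" by (simp add: boot_ecdf_def)
    have "(\<Sum>i<n. indicator {..y} (x i) :: real) = (\<Sum>i\<in>?A. 1)"
      by (rule sum.mono_neutral_cong_right) (auto simp: indicator_def)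
    then have "ecdf n x y = real (card ?A) / real n" by (simp add: ecdf_def)
    then show ?thesis using boot n by (simp add: Y_def sum_subtractf diff_divide_distrib)
  qed
  have "measure_pmf.prob (multinomial_weights n) {w. \<exists>y. \<bar>boot_ecdf n w x y - ecdf n x y\<bar> > \<epsilon>}
     = measure_pmf.prob D {d. \<exists>y. \<bar>boot_ecdf n (\<lambda>i. card {j. j < n \<and> d j = i}) x y - ecdf n x y\<bar> > \<epsilon>}"
    by (simp add: multinomial_weights_def D_def vimage_def)
  also have "\<dots> \<le> measure_pmf.prob D (\<Union>A\<in>\<A>. \<Union>\<sigma>\<in>{1, -1}. {d. real n * \<epsilon> \<le> (\<Sum>j<n. \<sigma> * Y A j d)})"
  proof (rule measure_pmf.finite_measure_mono_AE)
    show "AE d in measure_pmf D. d \<in> {d. \<exists>y. \<bar>boot_ecdf n (\<lambda>i. card {j. j < n \<and> d j = i}) x y - ecdf n x y\<bar> > \<epsilon>}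
      \<longrightarrow> d \<in> (\<Union>A\<in>\<A>. \<Union>\<sigma>\<in>{1, -1}. {d. real n * \<epsilon> \<le> (\<Sum>j<n. \<sigma> * Y A j d)})"
      unfolding AE_measure_pmf_iff
    proof (intro ballI impI)
      fix d assume d: "d \<in> set_pmf D"
        and "d \<in> {d. \<exists>y. \<bar>boot_ecdf n (\<lambda>i. card {j. j < n \<and> d j = i}) x y - ecdf n x y\<bar> > \<epsilon>}"
      then obtain y where "\<epsilon> < \<bar>(\<Sum>j<n. Y {i. i < n \<and> x i \<le> y} j d) / real n\<bar>"
        using boot_diff[OF d] by auto
      then have "real n * \<epsilon> \<le> \<bar>\<Sum>j<n. Y {i. i < n \<and> x i \<le> y} j d\<bar>"
        using n by (simp add: abs_divide less_divide_eq mult.commute less_imp_le)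
      then have "\<exists>\<sigma>\<in>{1, -1}. real n * \<epsilon> \<le> (\<Sum>j<n. \<sigma> * Y {i. i < n \<and> x i \<le> y} j d)"
        by (auto simp: sum_negf abs_if split: if_splits)
      then show "d \<in> (\<Union>A\<in>\<A>. \<Union>\<sigma>\<in>{1, -1}. {d. real n * \<epsilon> \<le> (\<Sum>j<n. \<sigma> * Y A j d)})"
        using \<A>_all[of y] by blast
    qed
  qed auto
  also have "\<dots> \<le> (\<Sum>A\<in>\<A>. \<Sum>\<sigma>\<in>{1, -1}. measure_pmf.prob D {d. real n * \<epsilon> \<le> (\<Sum>j<n. \<sigma> * Y A j d)})"
  proof (rule order.trans)
    show "measure_pmf.prob D (\<Union>A\<in>\<A>. \<Union>\<sigma>\<in>{1, -1}. {d. real n * \<epsilon> \<le> (\<Sum>j<n. \<sigma> * Y A j d)})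
        \<le> (\<Sum>A\<in>\<A>. measure_pmf.prob D (\<Union>\<sigma>\<in>{1, -1}. {d. real n * \<epsilon> \<le> (\<Sum>j<n. \<sigma> * Y A j d)}))"
      by (rule measure_pmf.finite_measure_subadditive_finite[OF fin\<A>]) simp
    show "\<dots> \<le> (\<Sum>A\<in>\<A>. \<Sum>\<sigma>\<in>{1, -1}. measure_pmf.prob D {d. real n * \<epsilon> \<le> (\<Sum>j<n. \<sigma> * Y A j d)})"
    proof (rule sum_mono)
      fix A
      show "measure_pmf.prob D (\<Union>\<sigma>\<in>{1, -1}. {d. real n * \<epsilon> \<le> (\<Sum>j<n. \<sigma> * Y A j d)})
          \<le> (\<Sum>\<sigma>\<in>{1, -1}. measure_pmf.prob D {d. real n * \<epsilon> \<le> (\<Sum>j<n. \<sigma> * Y A j d)})"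
        by (rule measure_pmf.finite_measure_subadditive_finite) simp_all
    qed
  qed
  also have "\<dots> \<le> (\<Sum>A\<in>\<A>. \<Sum>\<sigma>\<in>{1, -1::real}. exp (- (real n * \<epsilon>\<^sup>2 / 4)))"
  proof (intro sum_mono)
    fix A and \<sigma> :: real
    assume A: "A \<in> \<A>" and "\<sigma> \<in> {1, -1}"
    then have "\<bar>\<sigma>\<bar> = 1" by auto
    then show "measure_pmf.prob D {d. real n * \<epsilon> \<le> (\<Sum>j<n. \<sigma> * Y A j d)} \<le> exp (- (real n * \<epsilon>\<^sup>2 / 4))"
      by (rule dev[OF A])
  qed
  also have "\<dots> = 2 * real (card \<A>) * exp (- (real n * \<epsilon>\<^sup>2 / 4))" by simp
  also have "\<dots> \<le> 2 * (real n + 1) * exp (- (real n * \<epsilon>\<^sup>2 / 4))"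
    using card\<A> by (intro mult_right_mono mult_left_mono) auto
  finally show ?thesis .
qed

subsection \<open>Weighted norms\<close>

text \<open>The derivative \<open>q * z powr (q - 1)\<close> is at most \<open>q\<close> on the unit
  interval. At \<open>y = 0\<close>, where \<open>powr\<close> has no derivative to feed the mean
  value theorem, \<open>x powr q \<le> x\<close> replaces it.\<close>

lemma powr_diff_le:
  fixes x y q :: real
  assumes "1 \<le> q" "0 \<le> x" "x \<le> 1" "0 \<le> y"
  shows "x powr q - y powr q \<le> q * \<bar>x - y\<bar>"
proof (cases "y < x")
  case True
  show ?thesis
  proof (cases "y = 0")
    case True
    have "x powr q \<le> x powr 1" using assms by (intro powr_mono') auto
    also have "\<dots> \<le> q * x" using assms mult_right_mono[of 1 q x] by simp
    finally show ?thesis using True assms by simp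
  next
    case False
    then have y: "0 < y" using assms by simp
    have "\<exists>z. y < z \<and> z < x \<and> x powr q - y powr q = (x - y) * (q * z powr (q - 1))"
      using True y by (intro MVT2) (auto intro!: has_real_derivative_powr)
    then obtain z where z: "y < z" "z < x" "x powr q - y powr q = (x - y) * (q * z powr (q - 1))" by blast
    have "z powr (q - 1) \<le> 1" using z y assms by (intro powr_le1) auto
    then have "q * z powr (q - 1) \<le> q * 1" using assms by (intro mult_left_mono) auto
    then have "(x - y) * (q * z powr (q - 1)) \<le> (x - y) * q" using True by (intro mult_left_mono) auto
    then show ?thesis using z True by (simp add: mult.commute)
  qed
next
  case False
  then have "x powr q \<le> y powr q" using assms by (intro powr_mono2) auto
  moreover have "0 \<le> q * \<bar>x - y\<bar>" using assms by simp
  ultimately show ?thesis by linarith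
qed

lemma enn2real_ge_1: "1 \<le> p \<Longrightarrow> p \<noteq> \<infinity> \<Longrightarrow> 1 \<le> enn2real p"
  using enn2real_mono[of 1 p] by (simp add: less_top)

lemma wnorm_le:
  assumes p: "1 \<le> p" and g: "\<And>x. 0 \<le> x \<Longrightarrow> 0 < g x" "set_integrable lebesgue {0..} g"
    and b: "\<And>x. 0 \<le> x \<Longrightarrow> \<bar>\<theta> x\<bar> \<le> b"
  shows "wnorm g p \<theta> \<le> b * wnorm g p (\<lambda>_. 1)"
proof (cases "p = \<infinity>")
  case True
  have "(SUP x\<in>{0..}. \<bar>\<theta> x\<bar>) \<le> b" by (rule cSUP_least) (use b in auto)
  then show ?thesis using True by (simp add: wnorm_def)
next
  case False
  define q where "q = enn2real p"
  have q: "1 \<le> q" using enn2real_ge_1 p False by (simp add: q_def)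
  have b0: "0 \<le> b" using b[of 0] by simp
  define G where "G = (LINT x:{0..}|lebesgue. g x)"
  have G: "0 \<le> G" unfolding G_def set_lebesgue_integral_def
    using g(1) by (intro integral_nonneg_AE) (auto simp: indicator_def less_imp_le)
  have "(LINT x:{0..}|lebesgue. \<bar>\<theta> x\<bar> powr q * g x) \<le> (LINT x:{0..}|lebesgue. b powr q * g x)"
    unfolding set_lebesgue_integral_def
  \<comment> \<open>This rule asks for integrability of the dominating function only; if the left
    integrand is not integrable, its integral is 0 by convention and the bound still holds.\<close>
  proof (rule integral_mono')
    show "integrable lebesgue (\<lambda>x. indicator {0..} x *\<^sub>R (b powr q * g x))"
      unfolding set_integrable_def[symmetric] using g(2) by (rule set_integrable_mult_right)
    fix x :: real
    show "indicator {0..} x *\<^sub>R (\<bar>\<theta> x\<bar> powr q * g x) \<le> indicator {0..} x *\<^sub>R (b powr q * g x)"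
      using b[of x] g(1)[of x] q by (auto simp: indicator_def intro!: mult_right_mono powr_mono2)
    show "0 \<le> indicator {0..} x *\<^sub>R (b powr q * g x)"
      using g(1)[of x] by (auto simp: indicator_def less_imp_le)
  qed
  also have "\<dots> = b powr q * G" by (simp add: G_def)
  finally have "wnorm g p \<theta> \<le> (b powr q * G) powr (1 / q)"
    using False q g(1) unfolding wnorm_def q_def[symmetric]
    by (auto intro!: powr_mono2 integral_nonneg_AE simp: set_lebesgue_integral_def indicator_def less_imp_le)
  also have "\<dots> = b * G powr (1 / q)" using b0 G q by (simp add: powr_mult powr_powr)
  also have "G powr (1 / q) = wnorm g p (\<lambda>_. 1)" using False by (simp add: wnorm_def G_def q_def)
  finally show ?thesis .
qed

lemma wnorm_nonneg:
  assumes "\<And>x. 0 \<le> x \<Longrightarrow> \<bar>\<theta> x\<bar> \<le> b"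
  shows "0 \<le> wnorm g p \<theta>"
proof (cases "p = \<infinity>")
  case True
  have "\<bar>\<theta> 0\<bar> \<le> (SUP x\<in>{0..}. \<bar>\<theta> x\<bar>)"
    by (rule cSUP_upper) (use assms in \<open>auto intro!: bdd_aboveI2[of _ _ b]\<close>)
  then show ?thesis using True by (simp add: wnorm_def)
qed (simp add: wnorm_def)

lemma set_integrable_powr_weight:
  fixes g \<theta> :: "real \<Rightarrow> real"
  assumes g: "\<And>x. 0 \<le> x \<Longrightarrow> 0 < g x" "set_integrable lebesgue {0..} g"
    and \<theta>: "set_borel_measurable lebesgue {0..} \<theta>" "\<And>x. 0 \<le> x \<Longrightarrow> \<bar>\<theta> x\<bar> \<le> b" and q: "0 \<le> q"
  shows "set_integrable lebesgue {0..} (\<lambda>x. \<bar>\<theta> x\<bar> powr q * g x)"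
  unfolding set_integrable_def
proof (rule Bochner_Integration.integrable_bound)
  show "integrable lebesgue (\<lambda>x. b powr q * (indicator {0..} x *\<^sub>R g x))"
    using g(2) unfolding set_integrable_def by (rule integrable_mult_right)
  have gm: "(\<lambda>x. indicator {0..} x * g x) \<in> borel_measurable lebesgue"
    using borel_measurable_integrable[OF g(2)[unfolded set_integrable_def]] by simp
  have \<theta>m: "(\<lambda>x. indicator {0..} x * \<theta> x) \<in> borel_measurable lebesgue"
    using \<theta>(1) by (simp add: set_borel_measurable_def)
  have "(\<lambda>x. \<bar>indicator {0..} x * \<theta> x\<bar> powr q * (indicator {0..} x * g x)) \<in> borel_measurable lebesgue"
    using gm \<theta>m by measurable
  also have "(\<lambda>x. \<bar>indicator {0..} x * \<theta> x\<bar> powr q * (indicator {0..} x * g x))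
      = (\<lambda>x. indicator {0..} x *\<^sub>R (\<bar>\<theta> x\<bar> powr q * g x))"
    by (auto simp: indicator_def)
  finally show "(\<lambda>x. indicator {0..} x *\<^sub>R (\<bar>\<theta> x\<bar> powr q * g x)) \<in> borel_measurable lebesgue" .
  show "AE x in lebesgue. norm (indicator {0..} x *\<^sub>R (\<bar>\<theta> x\<bar> powr q * g x))
      \<le> norm (b powr q * (indicator {0..} x *\<^sub>R g x))"
    using g(1) \<theta>(2) q
    by (auto simp: indicator_def abs_mult less_imp_le intro!: AE_I2 mult_right_mono powr_mono2)
qed

text \<open>Turns a positive norm at the limit into a fixed positive lower bound for all uniformly
  close functions. For finite \<open>p\<close> it compares the integrals of the powers, using that
  \<open>powr\<close> is Lipschitz on the unit interval, in place of a triangle inequality for the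
  norm.\<close>

lemma wnorm_lower_bound:
  assumes p: "1 \<le> p" and g: "\<And>x. 0 \<le> x \<Longrightarrow> 0 < g x" "set_integrable lebesgue {0..} g"
    and am: "set_borel_measurable lebesgue {0..} a" and a: "\<And>x. 0 \<le> x \<Longrightarrow> 0 \<le> a x \<and> a x \<le> 1"
    and pos: "0 < wnorm g p a"
  shows "\<exists>\<delta>>0. \<exists>\<eta>>0. \<forall>b. set_borel_measurable lebesgue {0..} b \<longrightarrow> (\<forall>x\<ge>0. 0 \<le> b x \<and> b x \<le> 1) \<longrightarrow>
      (\<forall>x\<ge>0. \<bar>a x - b x\<bar> \<le> \<delta>) \<longrightarrow> \<eta> \<le> wnorm g p b"
proof (cases "p = \<infinity>")
  case True
  define \<eta> where "\<eta> = wnorm g p a / 2"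
  have "\<eta> \<le> wnorm g p b"
    if b: "\<And>x. 0 \<le> x \<Longrightarrow> 0 \<le> b x \<and> b x \<le> 1" and ab: "\<And>x. 0 \<le> x \<Longrightarrow> \<bar>a x - b x\<bar> \<le> \<eta>" for b
  proof -
    have "(SUP x\<in>{0..}. \<bar>a x\<bar>) \<le> (SUP x\<in>{0..}. \<bar>b x\<bar>) + \<eta>"
    proof (rule cSUP_least)
      fix x :: real assume x: "x \<in> {0..}"
      have "\<bar>b x\<bar> \<le> (SUP x\<in>{0..}. \<bar>b x\<bar>)"
        by (rule cSUP_upper[OF x]) (use b in \<open>auto intro!: bdd_aboveI2[of _ _ 1]\<close>)
      then show "\<bar>a x\<bar> \<le> (SUP x\<in>{0..}. \<bar>b x\<bar>) + \<eta>" using ab[of x] x by auto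
    qed auto
    then show ?thesis using True by (simp add: wnorm_def \<eta>_def)
  qed
  moreover have "0 < \<eta>" using pos by (simp add: \<eta>_def)
  ultimately show ?thesis by blast
next
  case False
  define q where "q = enn2real p"
  have q: "1 \<le> q" using enn2real_ge_1 p False by (simp add: q_def)
  define I where "I b = (LINT x:{0..}|lebesgue. \<bar>b x\<bar> powr q * g x)" for b :: "real \<Rightarrow> real"
  have wI: "wnorm g p b = I b powr (1 / q)" for b
    using False by (simp add: wnorm_def I_def q_def)
  have I_nonneg: "0 \<le> I b" for b
    unfolding I_def set_lebesgue_integral_def
    using g(1) by (intro integral_nonneg_AE) (auto simp: indicator_def less_imp_le)
  have Ia: "0 < I a" using pos I_nonneg[of a] by (cases "I a = 0") (auto simp: wI)
  define G where "G = (LINT x:{0..}|lebesgue. g x)"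
  have G: "0 \<le> G" unfolding G_def set_lebesgue_integral_def
    using g(1) by (intro integral_nonneg_AE) (auto simp: indicator_def less_imp_le)
  \<comment> \<open>Chosen so that the loss \<open>q * \<delta> * G\<close> is at most half of
    \<open>I a\<close>; the \<open>+ 1\<close> makes the denominator positive from
    \<open>0 \<le> G\<close> alone.\<close>
  define \<delta> where "\<delta> = I a / (2 * (q * G + 1))"
  have \<delta>: "0 < \<delta>" using Ia q G by (simp add: \<delta>_def add_nonneg_pos)
  have "(I a / 2) powr (1 / q) \<le> wnorm g p b"
    if bm: "set_borel_measurable lebesgue {0..} b" and b: "\<And>x. 0 \<le> x \<Longrightarrow> 0 \<le> b x \<and> b x \<le> 1"
      and ab: "\<And>x. 0 \<le> x \<Longrightarrow> \<bar>a x - b x\<bar> \<le> \<delta>" for b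
  proof -
    have inta: "set_integrable lebesgue {0..} (\<lambda>x. \<bar>a x\<bar> powr q * g x)"
      by (rule set_integrable_powr_weight[OF g am, of 1]) (use a q in \<open>auto simp: abs_le_iff\<close>)
    have intb: "set_integrable lebesgue {0..} (\<lambda>x. \<bar>b x\<bar> powr q * g x)"
      by (rule set_integrable_powr_weight[OF g bm, of 1]) (use b q in \<open>auto simp: abs_le_iff\<close>)
    have intg: "set_integrable lebesgue {0..} (\<lambda>x. (q * \<delta>) * g x)"
      using g(2) by (rule set_integrable_mult_right)
    have "I a \<le> (LINT x:{0..}|lebesgue. \<bar>b x\<bar> powr q * g x + (q * \<delta>) * g x)"
      unfolding I_def
    proof (rule set_integral_mono[OF inta set_integral_add(1)[OF intb intg]])
      fix x :: real assume x: "x \<in> {0..}"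
      have "a x powr q - b x powr q \<le> q * \<bar>a x - b x\<bar>"
        using a[of x] b[of x] x q by (intro powr_diff_le) auto
      also have "\<dots> \<le> q * \<delta>" using ab[of x] x q by (intro mult_left_mono) auto
      finally have "\<bar>a x\<bar> powr q \<le> \<bar>b x\<bar> powr q + q * \<delta>" using a[of x] b[of x] x by simp
      then have "\<bar>a x\<bar> powr q * g x \<le> (\<bar>b x\<bar> powr q + q * \<delta>) * g x"
        using g(1)[of x] x by (intro mult_right_mono) auto
      then show "\<bar>a x\<bar> powr q * g x \<le> \<bar>b x\<bar> powr q * g x + q * \<delta> * g x" by (simp add: algebra_simps)
    qed
    also have "\<dots> = I b + q * \<delta> * G"
      unfolding I_def G_def set_integral_add(2)[OF intb intg] by simp
    also have "q * \<delta> * G \<le> I a / 2"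
    proof -
      have "q * \<delta> * G = (q * G / (q * G + 1)) * (I a / 2)" by (simp add: \<delta>_def ac_simps)
      also have "\<dots> \<le> 1 * (I a / 2)" using q G Ia by (intro mult_right_mono) (auto simp: divide_le_eq add_nonneg_pos)
      finally show ?thesis by simp
    qed
    finally have "I a / 2 \<le> I b" by simp
    then show ?thesis unfolding wI using Ia q by (intro powr_mono2) auto
  qed
  moreover have "0 < (I a / 2) powr (1 / q)" using Ia by simp
  ultimately show ?thesis using \<delta> by blast
qed

section \<open>Measurability of majorants, norms and quantiles in the data\<close>

text \<open>Joint measurability is needed because the norm integrates over \<open>y\<close>. The
  countable formula covers \<open>y > 0\<close>, the endpoint has its own value, and the indicator
  removes the negative arguments.\<close>

lemma borel_measurable_maj:
  fixes \<theta> :: "'c \<Rightarrow> real \<Rightarrow> real"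
  assumes meas [measurable]: "\<And>z. 0 \<le> z \<Longrightarrow> (\<lambda>\<omega>. \<theta> \<omega> z) \<in> borel_measurable M"
    and K: "\<And>\<omega> z. 0 \<le> z \<Longrightarrow> \<bar>\<theta> \<omega> z\<bar> \<le> K"
    and rc: "\<And>\<omega> z. 0 \<le> z \<Longrightarrow> continuous (at_right z) (\<theta> \<omega>)"
  shows "(\<lambda>(\<omega>, y). indicator {0..} y * maj (\<theta> \<omega>) y) \<in> borel_measurable (M \<Otimes>\<^sub>M borel)"
proof -
  have upper: "\<theta> \<omega> z \<le> K" if "0 \<le> z" for \<omega> z using K[OF that, of \<omega>] by simp
  have countable: "countable (\<rat> \<inter> A)" for A :: "real set" using countable_rat by (rule countable_subset[rotated]) auto
  have S: "(\<lambda>u. SUP z\<in>\<rat> \<inter> {0..}. \<theta> (fst u) z + s * (snd u - z)) \<in> borel_measurable (M \<Otimes>\<^sub>M borel)"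
    if s: "s \<in> \<rat> \<inter> {0<..}" for s :: real
  proof (rule borel_measurable_cSUP[OF countable])
    fix z :: real assume "z \<in> \<rat> \<inter> {0..}"
    then have [measurable]: "(\<lambda>\<omega>. \<theta> \<omega> z) \<in> borel_measurable M" by auto
    show "(\<lambda>u. \<theta> (fst u) z + s * (snd u - z)) \<in> borel_measurable (M \<Otimes>\<^sub>M borel)" by measurable
  next
    fix u :: "'c \<times> real"
    show "bdd_above ((\<lambda>z. \<theta> (fst u) z + s * (snd u - z)) ` (\<rat> \<inter> {0..}))"
    proof (rule bdd_aboveI2)
      fix z :: real assume "z \<in> \<rat> \<inter> {0..}"
      then show "\<theta> (fst u) z + s * (snd u - z) \<le> K + s * snd u"
        using upper[of z "fst u"] s by (intro add_mono mult_left_mono) auto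
    qed
  qed
  have "(\<lambda>u. INF s\<in>\<rat> \<inter> {0<..}. SUP z\<in>\<rat> \<inter> {0..}. \<theta> (fst u) z + s * (snd u - z))
      \<in> borel_measurable (M \<Otimes>\<^sub>M borel)"
    by (rule borel_measurable_cINF_real[OF countable S])
  then have "(\<lambda>u. if 0 < snd u then INF s\<in>\<rat> \<inter> {0<..}. SUP z\<in>\<rat> \<inter> {0..}. \<theta> (fst u) z + s * (snd u - z)
      else if snd u = 0 then \<theta> (fst u) 0 else 0) \<in> borel_measurable (M \<Otimes>\<^sub>M borel)"
    using meas[of 0] by measurable
  also have "(\<lambda>u. if 0 < snd u then INF s\<in>\<rat> \<inter> {0<..}. SUP z\<in>\<rat> \<inter> {0..}. \<theta> (fst u) z + s * (snd u - z)
      else if snd u = 0 then \<theta> (fst u) 0 else 0) = (\<lambda>(\<omega>, y). indicator {0..} y * maj (\<theta> \<omega>) y)"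
    using maj_eq_INF_SUP[OF K rc] maj_zero[OF upper]
    by (force simp: fun_eq_iff indicator_def)
  finally show ?thesis .
qed

text \<open>Right continuity is asked only for \<open>y > 0\<close>, where majorants are known to be
  continuous; 0 is itself rational.\<close>

lemma SUP_eq_SUP_Rats:
  fixes D :: "real \<Rightarrow> real"
  assumes b: "\<And>y. 0 \<le> y \<Longrightarrow> \<bar>D y\<bar> \<le> b" and rc: "\<And>y. 0 < y \<Longrightarrow> continuous (at_right y) D"
  shows "(SUP y\<in>{0..}. \<bar>D y\<bar>) = (SUP y\<in>\<rat> \<inter> {0..}. \<bar>D y\<bar>)"
proof (rule antisym)
  have bdd: "bdd_above ((\<lambda>y. \<bar>D y\<bar>) ` A)" if "A \<subseteq> {0..}" for A
    using that b by (auto intro!: bdd_aboveI2[of _ _ b])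
  have "(0::real) \<in> \<rat> \<inter> {0..}" by simp
  then show "(SUP y\<in>\<rat> \<inter> {0..}. \<bar>D y\<bar>) \<le> (SUP y\<in>{0..}. \<bar>D y\<bar>)"
    by (intro cSUP_subset_mono bdd) auto
  show "(SUP y\<in>{0..}. \<bar>D y\<bar>) \<le> (SUP y\<in>\<rat> \<inter> {0..}. \<bar>D y\<bar>)" (is "_ \<le> ?R")
  proof (rule cSUP_least)
    fix y :: real assume y: "y \<in> {0..}"
    show "\<bar>D y\<bar> \<le> ?R"
    proof (rule ccontr)
      assume "\<not> \<bar>D y\<bar> \<le> ?R"
      then have gt: "?R < \<bar>D y\<bar>" by simp
      have upper: "\<bar>D z\<bar> \<le> ?R" if "z \<in> \<rat> \<inter> {0..}" for z by (rule cSUP_upper[OF that bdd]) auto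
      show False
      proof (cases "y = 0")
        case True
        then show ?thesis using upper[of 0] gt by simp
      next
        case False
        then have "((\<lambda>z. \<bar>D z\<bar>) \<longlongrightarrow> \<bar>D y\<bar>) (at_right y)"
          using rc[of y] y by (intro tendsto_rabs) (auto simp: continuous_within)
        then have "\<forall>\<^sub>F z in at_right y. ?R < \<bar>D z\<bar>" using gt by (rule order_tendstoD)
        then obtain z where "z \<in> \<rat>" "y < z" "?R < \<bar>D z\<bar>" using rat_right_approx by blast
        then show ?thesis using upper[of z] y by auto
      qed
    qed
  qed auto
qed

lemma borel_measurable_wnorm:
  fixes D :: "'c \<Rightarrow> real \<Rightarrow> real"
  assumes meas: "(\<lambda>(\<omega>, y). indicator {0..} y * D \<omega> y) \<in> borel_measurable (M \<Otimes>\<^sub>M borel)"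
    and b: "\<And>\<omega> y. 0 \<le> y \<Longrightarrow> \<bar>D \<omega> y\<bar> \<le> b"
    and rc: "\<And>\<omega> y. 0 < y \<Longrightarrow> continuous (at_right y) (D \<omega>)"
    and g: "set_integrable lebesgue {0..} g"
  shows "(\<lambda>\<omega>. wnorm g p (D \<omega>)) \<in> borel_measurable M"
proof (cases "p = \<infinity>")
  case True
  have countable: "countable (\<rat> \<inter> A)" for A :: "real set" using countable_rat by (rule countable_subset[rotated]) auto
  have "(\<lambda>\<omega>. SUP y\<in>\<rat> \<inter> {0..}. \<bar>D \<omega> y\<bar>) \<in> borel_measurable M"
  proof (rule borel_measurable_cSUP[OF countable])
    fix y :: real assume "y \<in> \<rat> \<inter> {0..}"
    moreover have "(\<lambda>\<omega>. (\<lambda>(\<omega>, y). indicator {0..} y * D \<omega> y) (\<omega>, y)) \<in> borel_measurable M"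
      by (rule measurable_compose[OF _ meas]) auto
    ultimately show "(\<lambda>\<omega>. \<bar>D \<omega> y\<bar>) \<in> borel_measurable M" by simp
  qed (use b in \<open>auto intro!: bdd_aboveI2[of _ _ b]\<close>)
  then show ?thesis using True SUP_eq_SUP_Rats[OF b rc] by (simp add: wnorm_def)
next
  case False
  define q where "q = enn2real p"
  have gm: "(\<lambda>x. indicator {0..} x * g x) \<in> borel_measurable lebesgue"
    using borel_measurable_integrable[OF g[unfolded set_integrable_def]] by simp
  \<comment> \<open>The weight is only Lebesgue measurable, while measurability of a parameter
    integral is obtained over the Borel product; so \<open>g\<close> is replaced by a Borel function
    equal to it almost everywhere.\<close>
  then obtain g' where g'm [measurable]: "g' \<in> borel_measurable lborel"
    and g': "AE x in lborel. indicator {0..} x * g x = g' x"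
    using completion_ex_borel_measurable_real by blast
  define h where "h \<omega> y = \<bar>indicator {0..} y * D \<omega> y\<bar> powr q * g' y" for \<omega> y
  note [measurable] = meas
  have hm: "case_prod h \<in> borel_measurable (M \<Otimes>\<^sub>M lborel)"
  proof -
    have "(\<lambda>u. \<bar>(\<lambda>(\<omega>, y). indicator {0..} y * D \<omega> y) u\<bar> powr q * g' (snd u)) \<in> borel_measurable (M \<Otimes>\<^sub>M borel)"
      using g'm by measurable
    then show ?thesis by (simp add: h_def case_prod_beta' cong: measurable_cong_sets)
  qed
  have eq: "(LINT y:{0..}|lebesgue. \<bar>D \<omega> y\<bar> powr q * g y) = (LINT y|lborel. h \<omega> y)" if \<omega>: "\<omega> \<in> space M" for \<omega>
  proof -
    have h\<omega>: "h \<omega> \<in> borel_measurable lborel"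
      using measurable_compose[OF _ hm, of "\<lambda>y. (\<omega>, y)" lborel] \<omega> by simp
    have Dm: "(\<lambda>y. indicator {0..} y * D \<omega> y) \<in> borel_measurable lborel"
    proof -
      have "(\<lambda>y. (\<lambda>(\<omega>, y). indicator {0..} y * D \<omega> y) (\<omega>, y)) \<in> borel_measurable lborel"
        by (rule measurable_compose[OF _ meas]) (use \<omega> in auto)
      then show ?thesis by simp
    qed
    have "(LINT y:{0..}|lebesgue. \<bar>D \<omega> y\<bar> powr q * g y)
        = (LINT y|lebesgue. \<bar>indicator {0..} y * D \<omega> y\<bar> powr q * (indicator {0..} y * g y))"
      unfolding set_lebesgue_integral_def
      by (rule Bochner_Integration.integral_cong) (auto simp: indicator_def)
    also have "\<dots> = (LINT y|lebesgue. h \<omega> y)"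
    proof (rule integral_cong_AE)
      show "(\<lambda>y. \<bar>indicator {0..} y * D \<omega> y\<bar> powr q * (indicator {0..} y * g y)) \<in> borel_measurable lebesgue"
        using measurable_completion[OF Dm] gm
        by measurable
      show "h \<omega> \<in> borel_measurable lebesgue" by (rule measurable_completion[OF h\<omega>])
      have "AE x in lebesgue. indicator {0..} x * g x = g' x" using g' by (rule AE_completion)
      then show "AE y in lebesgue. \<bar>indicator {0..} y * D \<omega> y\<bar> powr q * (indicator {0..} y * g y) = h \<omega> y"
        by eventually_elim (simp add: h_def)
    qed
    also have "\<dots> = (LINT y|lborel. h \<omega> y)" by (rule integral_completion[OF h\<omega>])
    finally show ?thesis .
  qed
  have "(\<lambda>\<omega>. (LINT y|lborel. h \<omega> y) powr (1 / q)) \<in> borel_measurable M"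
    using lborel.borel_measurable_lebesgue_integral[OF hm] by measurable
  then show ?thesis
    using False eq by (simp add: wnorm_def q_def[symmetric] cong: measurable_cong)
qed

text \<open>The set under \<open>Inf\<close> is upward closed, so \<open>Inf < c\<close> means that
  some rational below \<open>c\<close> belongs to it. Finite support makes each membership a
  condition on a finite sum of measurable terms.\<close>

lemma borel_measurable_pmf_quantile:
  fixes b :: "'c \<Rightarrow> 'd \<Rightarrow> real" and W :: "'d pmf"
  assumes fin: "finite (set_pmf W)" and meas [measurable]: "\<And>w. (\<lambda>\<omega>. b \<omega> w) \<in> borel_measurable M"
    and nonneg: "\<And>\<omega> w. 0 \<le> b \<omega> w" and \<beta>: "0 < \<beta>" "\<beta> \<le> 1"
  shows "(\<lambda>\<omega>. Inf {c. \<beta> \<le> measure_pmf.prob W {w. b \<omega> w \<le> c}}) \<in> borel_measurable M"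
proof (rule borel_measurableI_less)
  fix c :: real
  define S where "S \<omega> = {c. \<beta> \<le> measure_pmf.prob W {w. b \<omega> w \<le> c}}" for \<omega>
  have up: "c2 \<in> S \<omega>" if "c1 \<in> S \<omega>" "c1 \<le> c2" for c1 c2 \<omega>
  proof -
    have "measure_pmf.prob W {w. b \<omega> w \<le> c1} \<le> measure_pmf.prob W {w. b \<omega> w \<le> c2}"
      using that(2) by (intro measure_pmf.finite_measure_mono) auto
    then show ?thesis using that(1) by (simp add: S_def)
  qed
  have ne: "S \<omega> \<noteq> {}" for \<omega>
  proof -
    have "measure_pmf.prob W {w. b \<omega> w \<le> Max (b \<omega> ` set_pmf W)} = 1"
      using fin by (subst measure_pmf.prob_eq_1) (auto simp: AE_measure_pmf_iff)
    then have "Max (b \<omega> ` set_pmf W) \<in> S \<omega>" using \<beta> unfolding S_def by simp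
    then show ?thesis by blast
  qed
  have bdd: "bdd_below (S \<omega>)" for \<omega>
  proof (rule bdd_belowI)
    fix x assume x: "x \<in> S \<omega>"
    show "0 \<le> x"
    proof (rule ccontr)
      assume "\<not> 0 \<le> x"
      then have "{w. b \<omega> w \<le> x} = {}" using nonneg[of \<omega>] by (auto simp: not_le intro: less_le_trans)
      then show False using x \<beta> by (simp add: S_def)
    qed
  qed
  have prob_sum: "measure_pmf.prob W {w. b \<omega> w \<le> r} = (\<Sum>w\<in>set_pmf W. pmf W w * indicator {..r} (b \<omega> w))" for r \<omega>
  proof -
    have "measure_pmf.prob W {w. b \<omega> w \<le> r} = sum (pmf W) ({w. b \<omega> w \<le> r} \<inter> set_pmf W)"
      using fin by (simp flip: measure_measure_pmf_finite add: measure_Int_set_pmf)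
    also have "\<dots> = (\<Sum>w\<in>set_pmf W. pmf W w * indicator {..r} (b \<omega> w))"
      using fin by (intro sum.mono_neutral_cong_left) (auto simp: indicator_def)
    finally show ?thesis .
  qed
  have "{\<omega> \<in> space M. Inf (S \<omega>) < c} = (\<Union>r\<in>\<rat> \<inter> {..<c}. {\<omega> \<in> space M. r \<in> S \<omega>})"
  proof -
    have "Inf (S \<omega>) < c \<longleftrightarrow> (\<exists>r\<in>\<rat> \<inter> {..<c}. r \<in> S \<omega>)" for \<omega>
    proof
      assume "Inf (S \<omega>) < c"
      then obtain x where x: "x \<in> S \<omega>" "x < c" using cInf_less_iff[OF ne bdd] by blast
      then obtain r where "r \<in> \<rat>" "x < r" "r < c" using Rats_dense_in_real by blast
      then show "\<exists>r\<in>\<rat> \<inter> {..<c}. r \<in> S \<omega>" using up[OF x(1), of r] by auto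
    next
      assume "\<exists>r\<in>\<rat> \<inter> {..<c}. r \<in> S \<omega>"
      then show "Inf (S \<omega>) < c" using cInf_less_iff[OF ne bdd] by auto
    qed
    then show ?thesis by auto
  qed
  also have "\<dots> \<in> sets M"
  proof (rule sets.countable_UN')
    show "countable (\<rat> \<inter> {..<c})" using countable_rat by (rule countable_subset[rotated]) auto
    show "(\<lambda>r. {\<omega> \<in> space M. r \<in> S \<omega>}) ` (\<rat> \<inter> {..<c}) \<subseteq> sets M"
    proof (rule image_subsetI)
      fix r
      show "{\<omega> \<in> space M. r \<in> S \<omega>} \<in> sets M" unfolding S_def prob_sum by simp
    qed
  qed
  finally show "{\<omega> \<in> space M. Inf {c. \<beta> \<le> measure_pmf.prob W {w. b \<omega> w \<le> c}} < c} \<in> sets M"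
    by (simp add: S_def)
qed

subsection \<open>The bootstrap\<close>

lemma abs_maj_le:
  assumes "\<And>y. 0 \<le> y \<Longrightarrow> \<bar>\<theta> y\<bar> \<le> K" "0 \<le> x"
  shows "\<bar>maj \<theta> x\<bar> \<le> K"
proof -
  have up: "\<theta> y \<le> K" if "0 \<le> y" for y using assms(1)[OF that] by simp
  show ?thesis
    using maj_le_const[of \<theta> K x, OF up assms(2)] le_maj[of \<theta> K x, OF up assms(2)] assms(1)[OF assms(2)]
    by auto
qed

text \<open>Common form of the empirical distribution, its bootstrap version and their combinations:
  only the coefficients differ, and for fixed weights these do not depend on the data.\<close>

definition step_fun :: "nat \<Rightarrow> (nat \<Rightarrow> real) \<Rightarrow> (nat \<Rightarrow> real) \<Rightarrow> real \<Rightarrow> real" where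
  "step_fun n c x y = (\<Sum>i<n. c i * indicator {..y} (x i))"

lemma abs_step_fun_le: "\<bar>step_fun n c x y\<bar> \<le> (\<Sum>i<n. \<bar>c i\<bar>)"
  unfolding step_fun_def by (rule order.trans[OF sum_abs]) (auto intro!: sum_mono simp: indicator_def)

lemma continuous_at_right_step_fun: "continuous (at_right y) (step_fun n c x)"
proof -
  have "continuous (at_right y) (\<lambda>z. indicator {..z} a :: real)" for a :: real
  proof -
    have "\<forall>\<^sub>F z in at_right y. (indicator {..z} a :: real) = indicator {..y} a"
    proof (cases "a \<le> y")
      case True
      then show ?thesis
        by (auto simp: eventually_at_right_field indicator_def intro!: exI[of _ "y + 1"])
    next
      case False
      then show ?thesis
        by (auto simp: eventually_at_right_field indicator_def intro!: exI[of _ a])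
    qed
    then show ?thesis by (simp add: continuous_within tendsto_eventually)
  qed
  then show ?thesis
    unfolding step_fun_def by (intro continuous_sum continuous_mult continuous_const)
qed

lemma abs_maj_step_fun_le: "0 \<le> y \<Longrightarrow> \<bar>maj (step_fun n c x) y\<bar> \<le> (\<Sum>i<n. \<bar>c i\<bar>)"
  by (rule abs_maj_le) (rule abs_step_fun_le)

lemma borel_measurable_step_fun:
  assumes [measurable]: "\<And>i. X i \<in> borel_measurable M"
  shows "(\<lambda>(\<omega>, y). step_fun n c (\<lambda>i. X i \<omega>) y) \<in> borel_measurable (M \<Otimes>\<^sub>M borel)"
proof -
  have "(\<lambda>(\<omega>, y). step_fun n c (\<lambda>i. X i \<omega>) y)
      = (\<lambda>u. \<Sum>i<n. c i * (if X i (fst u) \<le> snd u then 1 else 0))"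
    unfolding step_fun_def case_prod_beta' by (intro ext sum.cong) (auto simp: indicator_def)
  then show ?thesis by simp
qed

text \<open>Two majorants and one step function make the expression general enough for both the test
  statistic and the bootstrap statistic.\<close>

lemma borel_measurable_wnorm_step_fun:
  assumes X [measurable]: "\<And>i. X i \<in> borel_measurable M" and g: "set_integrable lebesgue {0..} g"
  shows "(\<lambda>\<omega>. wnorm g p (\<lambda>y. r * maj (step_fun n a (\<lambda>i. X i \<omega>)) y + s * maj (step_fun n b (\<lambda>i. X i \<omega>)) y
      + step_fun n c (\<lambda>i. X i \<omega>) y)) \<in> borel_measurable M"
proof (rule borel_measurable_wnorm[OF _ _ _ g,
    where b = "\<bar>r\<bar> * (\<Sum>i<n. \<bar>a i\<bar>) + \<bar>s\<bar> * (\<Sum>i<n. \<bar>b i\<bar>) + (\<Sum>i<n. \<bar>c i\<bar>)"])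
  have maj_meas [measurable]: "(\<lambda>u. indicator {0..} (snd u) * maj (step_fun n d (\<lambda>i. X i (fst u))) (snd u))
      \<in> borel_measurable (M \<Otimes>\<^sub>M borel)" for d
  proof -
    have "(\<lambda>\<omega>. step_fun n d (\<lambda>i. X i \<omega>) z) \<in> borel_measurable M" for z
      using measurable_compose[OF _ borel_measurable_step_fun[OF X], of "\<lambda>\<omega>. (\<omega>, z)" M] by simp
    then have "(\<lambda>(\<omega>, y). indicator {0..} y * maj (step_fun n d (\<lambda>i. X i \<omega>)) y) \<in> borel_measurable (M \<Otimes>\<^sub>M borel)"
      using borel_measurable_maj[of "\<lambda>\<omega>. step_fun n d (\<lambda>i. X i \<omega>)" M "\<Sum>i<n. \<bar>d i\<bar>"]
        abs_step_fun_le continuous_at_right_step_fun by blast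
    then show ?thesis by (simp add: case_prod_beta')
  qed
  have [measurable]: "(\<lambda>u. step_fun n c (\<lambda>i. X i (fst u)) (snd u)) \<in> borel_measurable (M \<Otimes>\<^sub>M borel)"
    using borel_measurable_step_fun[OF X] by (simp add: case_prod_beta')
  have "(\<lambda>u. r * (indicator {0..} (snd u) * maj (step_fun n a (\<lambda>i. X i (fst u))) (snd u))
      + s * (indicator {0..} (snd u) * maj (step_fun n b (\<lambda>i. X i (fst u))) (snd u))
      + indicator {0..} (snd u) * step_fun n c (\<lambda>i. X i (fst u)) (snd u)) \<in> borel_measurable (M \<Otimes>\<^sub>M borel)"
    by measurable
  then show "(\<lambda>(\<omega>, y). indicator {0..} y * (r * maj (step_fun n a (\<lambda>i. X i \<omega>)) y
      + s * maj (step_fun n b (\<lambda>i. X i \<omega>)) y + step_fun n c (\<lambda>i. X i \<omega>) y)) \<in> borel_measurable (M \<Otimes>\<^sub>M borel)"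
    by (simp add: case_prod_beta' algebra_simps)
next
  fix \<omega> and y :: real
  assume y: "0 \<le> y"
  have "\<bar>r * maj (step_fun n a (\<lambda>i. X i \<omega>)) y\<bar> \<le> \<bar>r\<bar> * (\<Sum>i<n. \<bar>a i\<bar>)"
    "\<bar>s * maj (step_fun n b (\<lambda>i. X i \<omega>)) y\<bar> \<le> \<bar>s\<bar> * (\<Sum>i<n. \<bar>b i\<bar>)"
    unfolding abs_mult using y by (auto intro!: mult_left_mono abs_maj_step_fun_le)
  then show "\<bar>r * maj (step_fun n a (\<lambda>i. X i \<omega>)) y + s * maj (step_fun n b (\<lambda>i. X i \<omega>)) y
      + step_fun n c (\<lambda>i. X i \<omega>) y\<bar> \<le> \<bar>r\<bar> * (\<Sum>i<n. \<bar>a i\<bar>) + \<bar>s\<bar> * (\<Sum>i<n. \<bar>b i\<bar>) + (\<Sum>i<n. \<bar>c i\<bar>)"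
    using abs_step_fun_le[of n c "\<lambda>i. X i \<omega>" y] by linarith
next
  fix \<omega> and y :: real
  assume y: "0 < y"
  have "continuous (at_right y) (maj (step_fun n d (\<lambda>i. X i \<omega>)))" for d
  proof -
    have "step_fun n d (\<lambda>i. X i \<omega>) z \<le> (\<Sum>i<n. \<bar>d i\<bar>)" for z
      using abs_step_fun_le[of n d "\<lambda>i. X i \<omega>" z] by simp
    from continuous_on_maj[OF this] have "isCont (maj (step_fun n d (\<lambda>i. X i \<omega>))) y"
      using y by (simp add: continuous_on_eq_continuous_at)
    then show ?thesis by (rule continuous_at_imp_continuous_at_within)
  qed
  then show "continuous (at_right y) (\<lambda>y. r * maj (step_fun n a (\<lambda>i. X i \<omega>)) y
      + s * maj (step_fun n b (\<lambda>i. X i \<omega>)) y + step_fun n c (\<lambda>i. X i \<omega>) y)"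
    by (intro continuous_intros continuous_at_right_step_fun)
qed

lemma ecdf_eq_step_fun: "ecdf n x = step_fun n (\<lambda>_. 1 / real n) x"
  unfolding ecdf_def step_fun_def sum_distrib_left ..

lemma boot_ecdf_eq_step_fun: "boot_ecdf n w x = step_fun n (\<lambda>i. real (w i) / real n) x"
  unfolding boot_ecdf_def step_fun_def sum_distrib_left by (intro ext sum.cong) auto

lemma ecdf_bounds: "0 \<le> ecdf n x y" "ecdf n x y \<le> 1"
proof -
  show "0 \<le> ecdf n x y" by (auto simp: ecdf_def intro!: sum_nonneg divide_nonneg_nonneg)
  have "(\<Sum>i<n. indicator {..y} (x i) :: real) \<le> (\<Sum>i<n. 1)" by (intro sum_mono) (auto simp: indicator_def)
  then show "ecdf n x y \<le> 1" by (auto simp: ecdf_def divide_le_eq)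
qed

lemma step_fun_diff: "step_fun n a x y - step_fun n b x y = step_fun n (\<lambda>i. a i - b i) x y"
  unfolding step_fun_def left_diff_distrib sum_subtractf ..

lemma step_fun_add: "step_fun n a x y + step_fun n b x y = step_fun n (\<lambda>i. a i + b i) x y"
  unfolding step_fun_def distrib_right sum.distrib ..

lemma step_fun_cmult: "r * step_fun n a x y = step_fun n (\<lambda>i. r * a i) x y"
  unfolding step_fun_def sum_distrib_left mult.assoc ..

lemma borel_measurable_phi_ecdf:
  assumes "\<And>i. X i \<in> borel_measurable M" "set_integrable lebesgue {0..} g"
  shows "(\<lambda>\<omega>. \<phi> g p (ecdf n (\<lambda>i. X i \<omega>))) \<in> borel_measurable M"
proof -
  have "maj (ecdf n x) y - ecdf n x y = 1 * maj (step_fun n (\<lambda>_. 1 / real n) x) y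
      + 0 * maj (step_fun n (\<lambda>_. 0) x) y + step_fun n (\<lambda>i. - 1 * (1 / real n)) x y" for x y
    unfolding ecdf_eq_step_fun step_fun_cmult[symmetric] by simp
  then show ?thesis
    unfolding \<phi>_def by (simp only: borel_measurable_wnorm_step_fun[OF assms])
qed

lemma borel_measurable_boot_stat:
  assumes "\<And>i. X i \<in> borel_measurable M" "set_integrable lebesgue {0..} g"
  shows "(\<lambda>\<omega>. boot_stat g p n t (\<lambda>i. X i \<omega>) w) \<in> borel_measurable M"
proof -
  define h where "h = (\<lambda>i. sqrt (real n) * (real (w i) / real n - 1 / real n))"
  have h: "sqrt (real n) * (boot_ecdf n w x y - ecdf n x y) = step_fun n h x y" for x y
    unfolding ecdf_eq_step_fun boot_ecdf_eq_step_fun step_fun_diff step_fun_cmult h_def ..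
  have "(\<lambda>z. ecdf n x z + t * step_fun n h x z) = step_fun n (\<lambda>i. 1 / real n + t * h i) x" for x
    unfolding ecdf_eq_step_fun step_fun_cmult step_fun_add ..
  then have "maj_deriv_est n t x (step_fun n h x) y - step_fun n h x y
      = (1 / t) * maj (step_fun n (\<lambda>i. 1 / real n + t * h i) x) y
        + (- 1 / t) * maj (step_fun n (\<lambda>_. 1 / real n) x) y + step_fun n (\<lambda>i. - 1 * h i) x y" for x y
    unfolding step_fun_cmult[symmetric] by (simp add: maj_deriv_est_def ecdf_eq_step_fun diff_divide_distrib)
  then show ?thesis
    unfolding boot_stat_def Let_def h by (simp only: borel_measurable_wnorm_step_fun[OF assms])
qed

lemma finite_set_pmf_multinomial_weights: "0 < n \<Longrightarrow> finite (set_pmf (multinomial_weights n))"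
  by (auto simp: multinomial_weights_def set_Pi_pmf lessThan_empty_iff)

text \<open>The scale \<open>t\<close> cancels: the perturbation has size at most
  \<open>t * sqrt n * \<delta>\<close>, the majorant moves no more than that, and the difference
  quotient divides by \<open>t\<close>. The second summand comes from \<open>h\<close>
  itself.\<close>

lemma boot_stat_bound:
  assumes \<delta>: "\<And>y. \<bar>boot_ecdf n w x y - ecdf n x y\<bar> \<le> \<delta>" and t: "0 < t" and y: "0 \<le> y"
  defines "h \<equiv> \<lambda>y. sqrt (real n) * (boot_ecdf n w x y - ecdf n x y)"
  shows "\<bar>maj_deriv_est n t x h y - h y\<bar> \<le> 2 * sqrt (real n) * \<delta>"
proof -
  have h: "\<bar>h z\<bar> \<le> sqrt (real n) * \<delta>" for z
    using \<delta>[of z] by (simp add: h_def abs_mult mult_left_mono)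
  have "\<bar>maj (ecdf n x) y - maj (\<lambda>z. ecdf n x z + t * h z) y\<bar> \<le> t * (sqrt (real n) * \<delta>)"
  proof (rule maj_dist_le[where K = 1, OF _ _ y])
    show "\<bar>ecdf n x z\<bar> \<le> 1" for z using ecdf_bounds[of n x z] by simp
    show "\<bar>ecdf n x z - (ecdf n x z + t * h z)\<bar> \<le> t * (sqrt (real n) * \<delta>)" for z
      using h[of z] t by (simp add: abs_mult mult_left_mono)
  qed
  then have "\<bar>maj_deriv_est n t x h y\<bar> \<le> t * (sqrt (real n) * \<delta>) / t"
    using t unfolding maj_deriv_est_def abs_divide by (intro divide_mono) auto
  then show ?thesis using h[of y] t by auto
qed

lemma boot_stat_nonneg:
  assumes t: "0 < t"
  shows "0 \<le> boot_stat g p n t x w"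
proof -
  have "\<bar>boot_ecdf n w x y - ecdf n x y\<bar> \<le> (\<Sum>i<n. \<bar>real (w i) / real n - 1 / real n\<bar>)" for y
    unfolding ecdf_eq_step_fun boot_ecdf_eq_step_fun step_fun_diff by (rule abs_step_fun_le)
  from boot_stat_bound[OF this t] show ?thesis
    unfolding boot_stat_def Let_def by (intro wnorm_nonneg)
qed

text \<open>Outside an event of probability at most \<alpha> the bootstrap deviation is at most
  \<epsilon>, so the displayed constant belongs to the set whose infimum is the quantile. For fixed
  \<epsilon> this holds for every data vector once \<open>n\<close> is large.\<close>

lemma boot_quantile_le:
  assumes p: "1 \<le> p" and g: "\<And>x. 0 \<le> x \<Longrightarrow> 0 < g x" "set_integrable lebesgue {0..} g"
    and \<alpha>: "\<alpha> < 1" and t: "0 < t" and n: "0 < n" and \<epsilon>: "0 < \<epsilon>" "\<epsilon> \<le> 2"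
    and tail: "2 * (real n + 1) * exp (- (real n * \<epsilon>\<^sup>2 / 4)) \<le> \<alpha>"
  shows "boot_quantile g p \<alpha> n t x \<le> 2 * sqrt (real n) * \<epsilon> * wnorm g p (\<lambda>_. 1)"
  unfolding boot_quantile_def
proof (rule cInf_lower)
  let ?W = "multinomial_weights n" and ?c = "2 * sqrt (real n) * \<epsilon> * wnorm g p (\<lambda>_. 1)"
  let ?bad = "{w. \<exists>y. \<bar>boot_ecdf n w x y - ecdf n x y\<bar> > \<epsilon>}"
  have "1 - \<alpha> \<le> 1 - measure_pmf.prob ?W ?bad"
    using multinomial_sup_bound[OF n \<epsilon>, of x] tail by simp
  also have "\<dots> = measure_pmf.prob ?W (- ?bad)"
    using measure_pmf.prob_compl[of ?bad ?W] by (simp add: Compl_eq_Diff_UNIV)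
  also have "\<dots> \<le> measure_pmf.prob ?W {w. boot_stat g p n t x w \<le> ?c}"
  proof (rule measure_pmf.finite_measure_mono)
    show "- ?bad \<subseteq> {w. boot_stat g p n t x w \<le> ?c}"
    proof
      fix w assume "w \<in> - ?bad"
      then have "\<bar>boot_ecdf n w x y - ecdf n x y\<bar> \<le> \<epsilon>" for y by (auto simp: not_less)
      from boot_stat_bound[OF this t] show "w \<in> {w. boot_stat g p n t x w \<le> ?c}"
        unfolding boot_stat_def Let_def by (auto intro!: wnorm_le[OF p g])
    qed
  qed simp
  finally show "?c \<in> {c. 1 - \<alpha> \<le> measure_pmf.prob ?W {w. boot_stat g p n t x w \<le> c}}" by simp
  show "bdd_below {c. 1 - \<alpha> \<le> measure_pmf.prob ?W {w. boot_stat g p n t x w \<le> c}}"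
  proof (rule bdd_belowI)
    fix c assume c: "c \<in> {c. 1 - \<alpha> \<le> measure_pmf.prob ?W {w. boot_stat g p n t x w \<le> c}}"
    show "0 \<le> c"
    proof (rule ccontr)
      assume "\<not> 0 \<le> c"
      then have "{w. boot_stat g p n t x w \<le> c} = {}"
        using boot_stat_nonneg[OF t, of g p n x] by (auto simp: not_le intro: less_le_trans)
      then show False using c \<alpha> by simp
    qed
  qed
qed

lemma borel_measurable_boot_quantile:
  assumes X: "\<And>i. X i \<in> borel_measurable M" and g: "set_integrable lebesgue {0..} g"
    and "0 < \<alpha>" "\<alpha> < 1" "0 < t" "0 < n"
  shows "(\<lambda>\<omega>. boot_quantile g p \<alpha> n t (\<lambda>i. X i \<omega>)) \<in> borel_measurable M"
  unfolding boot_quantile_def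
  using assms by (intro borel_measurable_pmf_quantile finite_set_pmf_multinomial_weights
      borel_measurable_boot_stat boot_stat_nonneg) auto

text \<open>The gap of \<open>F\<close> below its line and the quadratic allowance in the modulus
  carry the same constant \<open>c\<close> and cancel, leaving only \<open>r\<close>.\<close>

lemma maj_ecdf_le:
  assumes gap: "\<And>z. 0 \<le> z \<Longrightarrow> c * (F z - F x)\<^sup>2 \<le> F x + s * (z - x) - F z"
    and modulus: "\<And>z. 0 \<le> z \<Longrightarrow> (ecdf n d z - F z) - (ecdf n d x - F x) \<le> c * (F z - F x)\<^sup>2 + r"
    and s: "0 \<le> s" and x: "0 \<le> x"
  shows "maj (ecdf n d) x - ecdf n d x \<le> r"
proof -
  have "maj (ecdf n d) x \<le> ecdf n d x + r"
  proof (rule maj_le_line[OF ecdf_bounds(2) s x])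
    fix z :: real assume "0 \<le> z"
    from gap[OF this] modulus[OF this] show "ecdf n d z + s * (x - z) \<le> ecdf n d x + r"
      by (simp add: algebra_simps)
  qed
  then show ?thesis by simp
qed

subsection \<open>Tangents of the distribution function\<close>

lemma at_within_atLeast_neq_bot:
  fixes x :: real
  assumes "a \<le> x"
  shows "at x within {a..} \<noteq> bot"
proof
  have "at_right x \<le> at x within {a..}" using assms by (intro at_le) auto
  moreover assume "at x within {a..} = bot"
  ultimately show False using trivial_limit_at_right_real[of x] by (simp add: bot_unique)
qed

lemma has_real_derivative_within_nonneg:
  assumes "(F has_real_derivative D) (at x within {0..})" and mono: "mono F" and x: "0 \<le> x"
  shows "0 \<le> D"
proof (rule tendsto_lowerbound)
  show "((\<lambda>y. (F y - F x) / (y - x)) \<longlongrightarrow> D) (at x within {0..})"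
    using assms(1) by (simp add: has_field_derivative_iff)
  have "0 \<le> (F y - F x) / (y - x)" for y
    using monoD[OF mono, of x y] monoD[OF mono, of y x]
    by (cases "x \<le> y") (auto intro: divide_nonneg_nonneg divide_nonpos_nonpos)
  then show "\<forall>\<^sub>F y in at x within {0..}. 0 \<le> (F y - F x) / (y - x)" by simp
  show "at x within {0..} \<noteq> bot" using x by (rule at_within_atLeast_neq_bot)
qed

lemma DERIV_of_within_atLeast:
  fixes x :: real
  assumes "(F has_real_derivative D) (at x within {0..})" "0 < x"
  shows "(F has_real_derivative D) (at x)"
proof -
  have "at x within {0..} = at x" using assms(2) by (intro at_within_interior) (auto simp: interior_real_atLeast)
  then show ?thesis using assms(1) by simp
qed

text \<open>A positive \<open>f'\<close> at \<open>x\<close> would persist to the right of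
  \<open>x\<close> and violate midpoint concavity there. Working strictly to the right of
  \<open>x\<close> covers \<open>x = 0\<close> with interior points only.\<close>

lemma concave_second_deriv_nonpos:
  fixes F f f' :: "real \<Rightarrow> real"
  assumes conc: "concave_on {0<..} F"
    and F: "\<And>x. 0 \<le> x \<Longrightarrow> (F has_real_derivative f x) (at x within {0..})"
    and f: "\<And>x. 0 \<le> x \<Longrightarrow> (f has_real_derivative f' x) (at x within {0..})"
    and f': "continuous_on {0..} f'" and x: "0 \<le> x"
  shows "f' x \<le> 0"
proof (rule ccontr)
  assume "\<not> f' x \<le> 0"
  then have pos: "0 < f' x" by simp
  have "(f' \<longlongrightarrow> f' x) (at x within {0..})" using f' x by (simp add: continuous_on_def)
  then have "\<forall>\<^sub>F y in at x within {0..}. 0 < f' y" using pos by (rule order_tendstoD)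
  then obtain d where d: "0 < d" "\<And>y. y \<in> {0..} \<Longrightarrow> y \<noteq> x \<Longrightarrow> dist y x < d \<Longrightarrow> 0 < f' y"
    unfolding eventually_at by blast
  define h where "h = d / 4"
  have h: "0 < h" using d by (simp add: h_def)
  define a m b where "a = x + h" and "m = x + 2 * h" and "b = x + 3 * h"
  note defs = a_def m_def b_def
  have f'pos: "0 < f' y" if "a \<le> y" "y \<le> b" for y
    using that d h x by (intro d(2)) (auto simp: defs h_def dist_real_def)
  obtain u where u: "a < u" "u < m" "F m - F a = (m - a) * f u"
    using MVT2[of a m F f] DERIV_of_within_atLeast[OF F] h x by (auto simp: defs)
  obtain v where v: "m < v" "v < b" "F b - F m = (b - m) * f v"
    using MVT2[of m b F f] DERIV_of_within_atLeast[OF F] h x by (auto simp: defs)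
  obtain w where w: "u < w" "w < v" "f v - f u = (v - u) * f' w"
    using MVT2[of u v f f'] DERIV_of_within_atLeast[OF f] u v h x by (auto simp: defs)
  have "0 < (v - u) * f' w" using w u v f'pos[of w] by (intro mult_pos_pos) auto
  then have "f u < f v" using w by simp
  then have "h * f u < h * f v" using h by simp
  then have "F m - F a < F b - F m" using u v by (simp add: defs)
  moreover have "(1 - 1/2) * F a + (1/2) * F b \<le> F ((1 - 1/2) *\<^sub>R a + (1/2) *\<^sub>R b)"
    by (rule concave_onD[OF conc]) (use h x in \<open>auto simp: defs\<close>)
  moreover have "(1 - 1/2) *\<^sub>R a + (1/2) *\<^sub>R b = m" by (simp add: defs field_simps)
  ultimately show False by simp
qed

text \<open>The differential inequality says that \<open>f * exp (\<beta> * F)\<close> is nonincreasing; this makes the gap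
  between \<open>F\<close> and its tangents quadratic in the increment of \<open>F\<close>, whatever the size of \<open>f\<close>.\<close>

lemma tangent_gap:
  fixes F f f' :: "real \<Rightarrow> real"
  assumes F: "\<And>x. 0 \<le> x \<Longrightarrow> (F has_real_derivative f x) (at x within {0..})"
    and f: "\<And>x. 0 \<le> x \<Longrightarrow> (f has_real_derivative f' x) (at x within {0..})"
    and ineq: "\<And>x. 0 \<le> x \<Longrightarrow> f' x \<le> - \<beta> * (f x)\<^sup>2" and \<beta>: "0 < \<beta>"
    and mono: "mono F" and F01: "\<And>x. 0 \<le> F x" "\<And>x. F x \<le> 1" and x: "0 \<le> x" and z: "0 \<le> z"
  shows "(1 - exp (- \<beta>)) / 2 * (F z - F x)\<^sup>2 \<le> F x + f x * (z - x) - F z"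
proof -
  \<comment> \<open>\<open>2 * c\<close> is the slope of the chord of
    \<open>1 - exp (- \<beta> * u)\<close> over the unit interval, the largest value for which the
    case \<open>z < x\<close> below works; it is also at most \<beta>, which the case
    \<open>x \<le> z\<close> needs.\<close>
  define c where "c = (1 - exp (- \<beta>)) / 2"
  have c: "2 * c \<le> \<beta>" using exp_ge_add_one_self[of "- \<beta>"] by (simp add: c_def)
  have f_nonneg: "0 \<le> f y" if "0 \<le> y" for y
    using has_real_derivative_within_nonneg[OF F[OF that] mono that] .
  have contF: "continuous_on {0..} F" and contf: "continuous_on {0..} f"
    using F f by (auto simp: continuous_on_eq_continuous_within intro: DERIV_continuous)
  have decr: "f b * exp (\<beta> * F b) \<le> f a * exp (\<beta> * F a)" if "0 \<le> a" "a \<le> b" for a b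
  proof (rule DERIV_nonpos_imp_decreasing_open[OF that(2)])
    fix y assume y: "a < y" "y < b"
    then have y0: "0 < y" using that by simp
    note [derivative_intros] = DERIV_of_within_atLeast[OF F[of y] y0] DERIV_of_within_atLeast[OF f[of y] y0]
    have "((\<lambda>y. f y * exp (\<beta> * F y)) has_real_derivative (f' y + \<beta> * (f y)\<^sup>2) * exp (\<beta> * F y)) (at y)"
      using y0 by (auto intro!: derivative_eq_intros simp: algebra_simps power2_eq_square)
    moreover have "(f' y + \<beta> * (f y)\<^sup>2) * exp (\<beta> * F y) \<le> 0"
      using ineq[of y] y0 by (simp add: mult_le_0_iff)
    ultimately show "\<exists>d. ((\<lambda>y. f y * exp (\<beta> * F y)) has_real_derivative d) (at y) \<and> d \<le> 0" by blast
  next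
    have "continuous_on {a..b} F" "continuous_on {a..b} f"
      using contF contf that by (auto elim!: continuous_on_subset)
    then show "continuous_on {a..b} (\<lambda>y. f y * exp (\<beta> * F y))" by (intro continuous_intros)
  qed
  have ratio: "f b \<le> f a * exp (- (\<beta> * (F b - F a)))" if "0 \<le> a" "a \<le> b" for a b
  proof -
    have "f b = f b * exp (\<beta> * F b) * exp (- (\<beta> * F b))" by (simp add: mult.assoc flip: exp_add)
    also have "\<dots> \<le> f a * exp (\<beta> * F a) * exp (- (\<beta> * F b))"
      using decr[OF that] by (intro mult_right_mono) auto
    also have "\<dots> = f a * exp (- (\<beta> * (F b - F a)))" by (simp add: mult.assoc algebra_simps flip: exp_add)
    finally show ?thesis .
  qed
  \<comment> \<open>\<open>H x = 0\<close>, so it suffices that \<open>H\<close> decreases before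
    \<open>x\<close> and increases after it.\<close>
  define H where "H y = F x + f x * (y - x) - F y - c * (F y - F x)\<^sup>2" for y
  define H' where "H' y = f x - f y - 2 * c * (F y - F x) * f y" for y
  have H_deriv: "(H has_real_derivative H' y) (at y)" if y0: "0 < y" for y
  proof -
    note [derivative_intros] = DERIV_of_within_atLeast[OF F[of y] y0]
    show ?thesis
      unfolding H_def H'_def using y0 by (auto intro!: derivative_eq_intros simp: algebra_simps)
  qed
  have contH: "continuous_on {a..b} H" if "0 \<le> a" for a b
  proof -
    have "continuous_on {a..b} F" using contF that by (auto elim!: continuous_on_subset)
    then show ?thesis unfolding H_def by (intro continuous_intros)
  qed
  have "0 \<le> H z"
  proof (cases "x \<le> z")
    case True
    have "H x \<le> H z"
    proof (rule DERIV_nonneg_imp_increasing_open[OF True _ contH[OF x]])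
      fix y assume y: "x < y" "y < z"
      then have y0: "0 < y" and u: "0 \<le> F y - F x" using x monoD[OF mono, of x y] by auto
      have "f y * exp (\<beta> * (F y - F x)) \<le> f x * exp (- (\<beta> * (F y - F x))) * exp (\<beta> * (F y - F x))"
        using ratio[of x y] x y by (intro mult_right_mono) auto
      then have 1: "f y * exp (\<beta> * (F y - F x)) \<le> f x" by (simp add: mult.assoc flip: exp_add)
      have "1 + 2 * c * (F y - F x) \<le> 1 + \<beta> * (F y - F x)" using c u by (simp add: mult_right_mono)
      also have "\<dots> \<le> exp (\<beta> * (F y - F x))" by (rule exp_ge_add_one_self)
      finally have "f y * (1 + 2 * c * (F y - F x)) \<le> f y * exp (\<beta> * (F y - F x))"
        using f_nonneg[of y] y0 by (intro mult_left_mono) auto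
      then have "0 \<le> H' y" using 1 by (simp add: H'_def algebra_simps)
      then show "\<exists>d. (H has_real_derivative d) (at y) \<and> 0 \<le> d" using H_deriv[OF y0] by blast
    qed
    then show ?thesis by (simp add: H_def)
  next
    case False
    have "H x \<le> H z"
    proof (rule DERIV_nonpos_imp_decreasing_open[OF _ _ contH[OF z]])
      fix y assume y: "z < y" "y < x"
      then have y0: "0 < y" and u: "0 \<le> F x - F y" using z monoD[OF mono, of y x] by auto
      have u1: "F x - F y \<le> 1" using F01(1)[of y] F01(2)[of x] by simp
      have e: "exp (- \<beta>) = 1 - 2 * c" by (simp add: c_def diff_divide_distrib)
      \<comment> \<open>On the unit interval the convex function \<open>exp (- \<beta> * u)\<close>
        lies below its chord \<open>1 - 2 * c * u\<close>; here
        \<open>u = F x - F y\<close>.\<close>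
      have "exp ((1 - (F x - F y)) *\<^sub>R 0 + (F x - F y) *\<^sub>R (- \<beta>))
          \<le> (1 - (F x - F y)) * exp 0 + (F x - F y) * exp (- \<beta>)"
        by (rule convex_onD[OF exp_convex]) (use u u1 in auto)
      then have "exp (- (\<beta> * (F x - F y))) \<le> 1 + 2 * c * (F y - F x)"
        unfolding e by (simp add: algebra_simps)
      then have "f y * exp (- (\<beta> * (F x - F y))) \<le> f y * (1 + 2 * c * (F y - F x))"
        using f_nonneg[of y] y0 by (intro mult_left_mono) auto
      then have "H' y \<le> 0" using ratio[of y x] y y0 by (simp add: H'_def algebra_simps)
      then show "\<exists>d. (H has_real_derivative d) (at y) \<and> d \<le> 0" using H_deriv[OF y0] by blast
    qed (use False in auto)
    then show ?thesis by (simp add: H_def)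
  qed
  then show ?thesis by (simp add: H_def c_def)
qed

section \<open>What the null hypothesis and the curvature condition give\<close>

lemma set_borel_measurable_maj_diff:
  assumes K: "\<And>y. 0 \<le> y \<Longrightarrow> \<theta> y \<le> K" and \<theta>: "\<theta> \<in> borel_measurable borel"
  shows "set_borel_measurable lebesgue {0..} (\<lambda>x. maj \<theta> x - \<theta> x)"
proof -
  have [measurable]: "(\<lambda>x. indicator {0<..} x * maj \<theta> x) \<in> borel_measurable borel"
    using borel_measurable_continuous_on_indicator[OF _ continuous_on_maj[OF K]] by simp
  have "(\<lambda>x. indicator {0<..} x * maj \<theta> x + indicator {0} x * \<theta> x - indicator {0..} x * \<theta> x) \<in> borel_measurable borel"
    using \<theta> by measurable
  also have "(\<lambda>x. indicator {0<..} x * maj \<theta> x + indicator {0} x * \<theta> x - indicator {0..} x * \<theta> x)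
      = (\<lambda>x. indicator {0..} x *\<^sub>R (maj \<theta> x - \<theta> x))"
    using maj_zero[OF K] by (auto simp: indicator_def fun_eq_iff)
  finally show ?thesis
    unfolding set_borel_measurable_def by (intro measurable_completion) simp
qed

text \<open>For finite \<open>p\<close> the difference vanishes almost everywhere; being continuous
  on the open half-line, it is nonzero only on an open null set, which is empty.\<close>

lemma phi_eq_0_imp_maj_eq:
  assumes p: "1 \<le> p" and g: "\<And>x. 0 \<le> x \<Longrightarrow> 0 < g x" "set_integrable lebesgue {0..} g"
    and F01: "\<And>x. 0 \<le> F x" "\<And>x. F x \<le> 1" and Fm: "F \<in> borel_measurable borel"
    and cont: "continuous_on {0..} F" and \<phi>: "\<phi> g p F = 0" and y: "0 < y"
  shows "maj F y = F y"
proof -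
  define d where "d x = maj F x - F x" for x
  have d01: "0 \<le> d x" "d x \<le> 1" if "0 \<le> x" for x
    using le_maj[of F 1 x] maj_le_const[of F 1 x] F01(1)[of x] F01(2) that by (auto simp: d_def)
  have dm: "set_borel_measurable lebesgue {0..} d"
    unfolding d_def by (rule set_borel_measurable_maj_diff[of _ 1]) (use F01 Fm in auto)
  have "d = (\<lambda>x. maj F x - F x)" by (simp add: d_def fun_eq_iff)
  then have w0: "wnorm g p d = 0" using \<phi> by (simp add: \<phi>_def)
  have "d y = 0"
  proof (cases "p = \<infinity>")
    case True
    have "\<bar>d y\<bar> \<le> (SUP x\<in>{0..}. \<bar>d x\<bar>)"
      by (rule cSUP_upper) (use y d01 in \<open>auto intro!: bdd_aboveI2[of _ _ 1]\<close>)
    then show ?thesis using w0 True by (simp add: wnorm_def)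
  next
    case False
    define q where "q = enn2real p"
    have q: "1 \<le> q" using enn2real_ge_1 p False by (simp add: q_def)
    have int: "set_integrable lebesgue {0..} (\<lambda>x. \<bar>d x\<bar> powr q * g x)"
      by (rule set_integrable_powr_weight[OF g dm, of 1]) (use d01 q in auto)
    have "(LINT x:{0..}|lebesgue. \<bar>d x\<bar> powr q * g x) = 0"
      using w0 False by (simp add: wnorm_def q_def)
    moreover have "0 \<le> indicator {0..} x *\<^sub>R (\<bar>d x\<bar> powr q * g x)" for x
      using g(1)[of x] by (cases "0 \<le> x") simp_all
    ultimately have "AE x in lebesgue. indicator {0..} x *\<^sub>R (\<bar>d x\<bar> powr q * g x) = 0"
      using integral_nonneg_eq_0_iff_AE[OF int[unfolded set_integrable_def]]
      by (simp add: set_lebesgue_integral_def)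
    then have ae: "AE x in lebesgue. x \<in> {0<..} \<longrightarrow> d x = 0"
    proof eventually_elim
      case (elim x)
      then show ?case using g(1)[of x] by (cases "0 < x") auto
    qed
    define U where "U = {0<..} \<inter> d -` (- {0})"
    have "continuous_on {0<..} d"
      unfolding d_def using cont by (intro continuous_on_diff continuous_on_maj[of _ 1] F01)
        (auto elim!: continuous_on_subset)
    then have "open U" unfolding U_def by (intro continuous_open_preimage) auto
    moreover have "U \<in> null_sets lebesgue"
    proof -
      have "U \<in> sets lebesgue" using \<open>open U\<close> by (simp add: borel_open)
      moreover have "AE x in lebesgue. x \<notin> U" using ae by eventually_elim (auto simp: U_def)
      ultimately show ?thesis by (simp add: AE_iff_null_sets)
    qed
    ultimately have "U = {}" using open_not_negligible by (auto simp: negligible_iff_null_sets)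
    then show ?thesis using y by (auto simp: U_def)
  qed
  then show ?thesis by (simp add: d_def)
qed

text \<open>The order relation controls only the absolute value of the infimum; the sign of
  \<open>f'\<close> makes the infimum nonnegative and removes the bars. Small \<epsilon> then
  reaches every \<open>x\<close> with \<open>F x < 1\<close>.\<close>

lemma neg_deriv_ratio_bound:
  fixes F f f' :: "real \<Rightarrow> real"
  assumes beta_asymp: "(\<lambda>\<epsilon>. INF x\<in>{0..quantile F (1 - \<epsilon>)}. - f' x / (f x)\<^sup>2) \<in> \<Theta>[at_right 0](\<lambda>_. 1)"
    and f'_nonpos: "\<And>x. 0 \<le> x \<Longrightarrow> f' x \<le> 0"
    and F: "\<And>x. 0 \<le> x \<Longrightarrow> (F has_real_derivative f x) (at x within {0..})"
    and mono: "mono F" and F_le: "\<And>x. F x \<le> 1" and F_lim: "(F \<longlongrightarrow> 1) at_top"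
  obtains \<beta> where "0 < \<beta>" "\<And>x. 0 \<le> x \<Longrightarrow> f' x \<le> - \<beta> * (f x)\<^sup>2"
proof -
  let ?r = "\<lambda>x. - f' x / (f x)\<^sup>2" and ?I = "\<lambda>\<epsilon>. INF x\<in>{0..quantile F (1 - \<epsilon>)}. - f' x / (f x)\<^sup>2"
  have r_nonneg: "0 \<le> ?r x" if "0 \<le> x" for x using f'_nonpos[OF that] by (intro divide_nonneg_nonneg) auto
  have "?I \<in> \<Omega>[at_right 0](\<lambda>_. 1)" using beta_asymp by (rule bigthetaD2)
  then obtain \<beta> where \<beta>: "0 < \<beta>" and ev: "\<forall>\<^sub>F \<epsilon> in at_right 0. \<beta> \<le> \<bar>?I \<epsilon>\<bar>"
    by (elim landau_omega.bigE) auto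
  obtain e where e: "0 < e" "\<And>\<epsilon>. 0 < \<epsilon> \<Longrightarrow> \<epsilon> < e \<Longrightarrow> \<beta> \<le> \<bar>?I \<epsilon>\<bar>"
    using ev unfolding eventually_at_right_field by blast
  have "f' x \<le> - \<beta> * (f x)\<^sup>2" if x: "0 \<le> x" for x
  proof (cases "F x < 1")
    case True
    define \<epsilon> where "\<epsilon> = min (e / 2) ((1 - F x) / 2)"
    have \<epsilon>: "0 < \<epsilon>" "\<epsilon> < e" "F x < 1 - \<epsilon>" using e True by (auto simp: \<epsilon>_def min_def field_simps)
    have "x \<le> quantile F (1 - \<epsilon>)"
      unfolding quantile_def
    proof (rule cInf_greatest)
      have "\<forall>\<^sub>F y in at_top. 1 - \<epsilon> < F y" using F_lim \<epsilon> by (intro order_tendstoD) auto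
      then obtain y where "1 - \<epsilon> < F y" by (auto simp: eventually_at_top_linorder)
      then show "{x. 1 - \<epsilon> \<le> F x} \<noteq> {}" by (auto intro!: exI[of _ y])
      fix y assume "y \<in> {x. 1 - \<epsilon> \<le> F x}"
      then have "F x < F y" using \<epsilon> by simp
      then show "x \<le> y" using monoD[OF mono, of y x] by (cases "x \<le> y") auto
    qed
    then have xin: "x \<in> {0..quantile F (1 - \<epsilon>)}" using x by simp
    have "0 \<le> ?I \<epsilon>" by (rule cINF_greatest) (use xin r_nonneg in auto)
    then have "\<beta> \<le> ?I \<epsilon>" using e(2)[of \<epsilon>] \<epsilon> by simp
    also have "?I \<epsilon> \<le> ?r x"
      by (rule cINF_lower[OF _ xin]) (use r_nonneg in \<open>auto intro!: bdd_belowI2[of _ 0]\<close>)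
    finally have le: "\<beta> \<le> ?r x" .
    \<comment> \<open>If \<open>f x\<close> were 0, division by zero would make the ratio 0,
      contradicting the lower bound \<open>\<beta> > 0\<close>.\<close>
    then have "f x \<noteq> 0" using \<beta> by auto
    then have "0 < (f x)\<^sup>2" by simp
    from le[unfolded pos_le_divide_eq[OF this]] show ?thesis by simp
  next
    case False
    have F1: "F y = 1" if "x \<le> y" for y
      using monoD[OF mono that] F_le[of y] False by simp
    \<comment> \<open>Where \<open>F\<close> has reached 1 it stays constant, so its right
      derivative is 0; the claim reduces to \<open>f' x \<le> 0\<close>.\<close>
    have "(F has_real_derivative f x) (at x within {x..})"
      using F[OF x] by (rule has_field_derivative_subset) (use x in auto)
    moreover have "(F has_real_derivative 0) (at x within {x..})"
    proof (rule has_field_derivative_transform_within[of "\<lambda>_. 1" _ _ _ 1])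
      show "((\<lambda>_. 1) has_real_derivative 0) (at x within {x..})" by simp
    qed (use F1 in auto)
    moreover have "at x within {x..} \<noteq> bot" by (simp add: at_within_atLeast_neq_bot)
    ultimately have "f x = 0" using has_field_derivative_unique by blast
    then show ?thesis using f'_nonpos[OF x] by simp
  qed
  then show ?thesis using that \<beta> by blast
qed

section \<open>Size and power of the test\<close>

theorem theorem3p1:
  fixes p :: ennreal and \<alpha> :: real and g :: "real \<Rightarrow> real"
    and M :: "'a measure" and X :: "nat \<Rightarrow> 'a \<Rightarrow> real"
    and F f f' :: "real \<Rightarrow> real"
    and N :: "'b measure" and B :: "real \<Rightarrow> 'b \<Rightarrow> real"
    and t \<kappa> :: "nat \<Rightarrow> real"
  assumes p: "1 \<le> p"
    and \<alpha>: "0 < \<alpha>" "\<alpha> < 1"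
    and g_pos: "\<And>x. 0 \<le> x \<Longrightarrow> 0 < g x"
    and g_L1: "set_integrable lebesgue {0..} g"
    and M: "prob_space M"
    and X_indep: "prob_space.indep_vars M (\<lambda>_. borel) X UNIV"
    and X_nonneg: "\<And>i \<omega>. \<omega> \<in> space M \<Longrightarrow> 0 \<le> X i \<omega>"
    and X_cdf: "\<And>i. cdf (distr M borel (X i)) = F"
    and X_density: "\<And>i. distributed M lborel (X i) (\<lambda>x. ennreal (f x) * indicator {0..} x)"
    and F_deriv: "\<And>x. 0 \<le> x \<Longrightarrow> (F has_real_derivative f x) (at x within {0..})"
    and f_deriv: "\<And>x. 0 \<le> x \<Longrightarrow> (f has_real_derivative f' x) (at x within {0..})"
    and f'_cont: "continuous_on {0..} f'"
    and beta_finite: "\<forall>\<^sub>F \<epsilon> in at_right 0.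
          bdd_below ((\<lambda>x. - f' x / (f x)\<^sup>2) ` {0..quantile F (1 - \<epsilon>)})"
    and beta_asymp: "(\<lambda>\<epsilon>. INF x\<in>{0..quantile F (1 - \<epsilon>)}. - f' x / (f x)\<^sup>2)
          \<in> \<Theta>[at_right 0](\<lambda>_. 1)"
    and F''_int: "(\<integral>\<^sup>+x\<in>{0..}. ennreal (sqrt \<bar>f' x\<bar>) \<partial>lborel)\<^sup>2 < \<infinity>"
    and t_pos: "\<And>n. 0 < t n"
    and t_lim: "t \<longlonglongrightarrow> 0"
    and t_rate: "filterlim (\<lambda>n. t n * sqrt (real n)) at_top sequentially"
    and \<kappa>_pos: "\<And>n. 0 < \<kappa> n"
    and \<kappa>_lim: "\<kappa> \<longlonglongrightarrow> 0"
    and \<kappa>_rate: "(\<lambda>n. ln (real n) powr (2/3) * real n powr (-1/6) / \<kappa> n) \<longlonglongrightarrow> 0"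
    and bridge: "brownian_bridge N B"
    and limit_law: "concave_on {0..} F \<and> \<not> strictly_concave_on {0..} F \<Longrightarrow>
          isCont (limit_cdf g p F N B) (quantile (limit_cdf g p F N B) (1 - \<alpha>)) \<and>
          strictly_increasing_at (limit_cdf g p F N B)
            (quantile (limit_cdf g p F N B) (1 - \<alpha>))"
  shows "(\<phi> g p F = 0 \<longrightarrow>
           limsup (\<lambda>n. ereal (measure M {\<omega> \<in> space M.
             sqrt (real n) * \<phi> g p (ecdf n (\<lambda>i. X i \<omega>))
               > critical_value g p \<alpha> n (t n) (\<kappa> n) (\<lambda>i. X i \<omega>)})) \<le> ereal \<alpha>) \<and>
         (\<phi> g p F > 0 \<longrightarrow>
           (\<lambda>n. measure M {\<omega> \<in> space M.
             sqrt (real n) * \<phi> g p (ecdf n (\<lambda>i. X i \<omega>))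
               > critical_value g p \<alpha> n (t n) (\<kappa> n) (\<lambda>i. X i \<omega>)}) \<longlonglongrightarrow> 1)"
proof -
  interpret prob_space M by (rule M)
  have rv [measurable]: "X i \<in> borel_measurable M" for i
    using X_indep by (auto simp: indep_vars_def)
  interpret D: real_distribution "distr M borel (X i)" for i
    by (intro real_distribution_distr rv)
  have F_prob: "F y = prob (X 0 -` {..y} \<inter> space M)" for y
  proof -
    have "F y = measure (distr M borel (X 0)) {..y}" using X_cdf[of 0] by (auto simp: cdf_def)
    then show ?thesis by (simp add: measure_distr)
  qed
  have F01: "0 \<le> F y" "F y \<le> 1" for y using F_prob[of y] by auto
  have mono: "mono F" unfolding X_cdf[of 0, symmetric] by (intro monoI D.cdf_nondecreasing)
  have F_lim: "(F \<longlongrightarrow> 1) at_top" using D.cdf_lim_at_top_prob[of 0] X_cdf[of 0] by simp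
  have Fm: "F \<in> borel_measurable borel" using mono by (rule borel_measurable_mono)
  have F_neg: "F y = 0" if "y < 0" for y
  proof -
    have "X 0 -` {..y} \<inter> space M = {}" using X_nonneg[of _ 0] that by force
    then show ?thesis by (simp add: F_prob)
  qed
  \<comment> \<open>A law with a density has no atom at 0; this anchors the intermediate value
    argument for \<open>onto\<close>.\<close>
  have F_0: "F 0 = 0"
  proof -
    have "emeasure M (X 0 -` {..0} \<inter> space M)
        = (\<integral>\<^sup>+x. ennreal (f x) * indicator {0..} x * indicator {..0} x \<partial>lborel)"
      by (rule distributed_emeasure[OF X_density]) simp
    also have "\<dots> = (\<integral>\<^sup>+x. 0 \<partial>(lborel :: real measure))"
    proof (rule nn_integral_cong_AE)
      show "AE x in lborel. ennreal (f x) * indicator {0..} x * indicator {..0} x = 0"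
        using AE_lborel_singleton[of "0::real"] by eventually_elim (auto simp: indicator_def)
    qed
    finally show ?thesis by (simp add: F_prob measure_def)
  qed
  have contF: "continuous_on {0..} F"
    using F_deriv by (auto simp: continuous_on_eq_continuous_within intro: DERIV_continuous)
  have onto: "\<exists>a. F a = q" if "0 < q" "q < 1" for q
  proof -
    have "\<forall>\<^sub>F y in at_top. q < F y" using F_lim that by (intro order_tendstoD) auto
    then obtain b where b: "\<And>y. b \<le> y \<Longrightarrow> q < F y" by (auto simp: eventually_at_top_linorder)
    have "\<exists>y\<ge>0. y \<le> max 0 b \<and> F y = q"
      by (rule IVT') (use F_0 that b[of "max 0 b"] contF in \<open>auto elim!: continuous_on_subset\<close>)
    then show ?thesis by blast
  qed
  have f_nonneg: "0 \<le> f x" if "0 \<le> x" for x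
    using has_real_derivative_within_nonneg[OF F_deriv[OF that] mono that] .
  define C where "C = wnorm g p (\<lambda>_. 1)"
  have C: "0 \<le> C" unfolding C_def by (rule wnorm_nonneg[of _ 1]) simp
  define \<rho> where "\<rho> n = (ln (real n) / real n) powr (2/3)" for n :: nat
  let ?ev = "\<lambda>n. {\<omega> \<in> space M. sqrt (real n) * \<phi> g p (ecdf n (\<lambda>i. X i \<omega>))
      > critical_value g p \<alpha> n (t n) (\<kappa> n) (\<lambda>i. X i \<omega>)}"
  have "limsup (\<lambda>n. ereal (prob (?ev n))) \<le> ereal \<alpha>" if H0: "\<phi> g p F = 0"
  proof -
    have maj_eq: "maj F y = F y" if "0 < y" for y
      using phi_eq_0_imp_maj_eq[OF p g_pos g_L1 F01 Fm contF H0 that] .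
    have "concave_on {0<..} (maj F)"
      using concave_on_maj[OF F01(2)] unfolding concave_on_def by (rule convex_on_subset) auto
    then have "concave_on {0<..} F"
      unfolding concave_on_iff
    proof (intro conjI ballI allI impI)
      fix x y u v :: real
      assume maj_conc: "convex {0<..} \<and> (\<forall>x\<in>{0<..}. \<forall>y\<in>{0<..}. \<forall>u\<ge>0. \<forall>v\<ge>0.
          u + v = 1 \<longrightarrow> u * maj F x + v * maj F y \<le> maj F (u *\<^sub>R x + v *\<^sub>R y))"
        and *: "x \<in> {0<..}" "y \<in> {0<..}" "0 \<le> u" "0 \<le> v" "u + v = 1"
      then have "u *\<^sub>R x + v *\<^sub>R y \<in> {0<..}" by (intro convexD) auto
      then show "u * F x + v * F y \<le> F (u *\<^sub>R x + v *\<^sub>R y)"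
        using maj_conc * maj_eq by (metis greaterThan_iff)
    qed auto
    then have "f' x \<le> 0" if "0 \<le> x" for x
      using concave_second_deriv_nonpos[OF _ F_deriv f_deriv f'_cont that] by blast
    then obtain \<beta> where \<beta>: "0 < \<beta>" "\<And>x. 0 \<le> x \<Longrightarrow> f' x \<le> - \<beta> * (f x)\<^sup>2"
      using neg_deriv_ratio_bound[OF beta_asymp _ F_deriv mono F01(2) F_lim] by metis
    \<comment> \<open>The constant of the tangent gap, so that the modulus event is built with
      exactly the allowance the gap can absorb.\<close>
    define c where "c = (1 - exp (- \<beta>)) / 2"
    have c: "0 < c" using \<beta> by (simp add: c_def)
    obtain A E where E: "\<And>n. E n \<in> events" "(\<lambda>n. prob (E n)) \<longlonglongrightarrow> 1"
      and modulus: "\<And>n \<omega> y z. 3 \<le> n \<Longrightarrow> \<omega> \<in> E n \<Longrightarrow>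
        (ecdf n (\<lambda>i. X i \<omega>) z - F z) - (ecdf n (\<lambda>i. X i \<omega>) y - F y) \<le> c * (F z - F y)\<^sup>2 + A * \<rho> n"
      unfolding \<rho>_def using modulus_event[OF X_indep X_cdf onto c] by metis
    have \<phi>_le: "\<phi> g p (ecdf n (\<lambda>i. X i \<omega>)) \<le> A * \<rho> n * C" if n: "3 \<le> n" and \<omega>: "\<omega> \<in> E n" for n \<omega>
      unfolding \<phi>_def C_def
    proof (rule wnorm_le[OF p g_pos g_L1])
      fix x :: real assume x: "0 \<le> x"
      have "maj (ecdf n (\<lambda>i. X i \<omega>)) x - ecdf n (\<lambda>i. X i \<omega>) x \<le> A * \<rho> n"
      proof (rule maj_ecdf_le[where c = c and F = F and s = "f x"])
        show "c * (F z - F x)\<^sup>2 \<le> F x + f x * (z - x) - F z" if "0 \<le> z" for z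
          unfolding c_def by (rule tangent_gap[OF F_deriv f_deriv \<beta>(2) \<beta>(1) mono F01 x that])
      qed (use modulus[OF n \<omega>] f_nonneg x in auto)
      moreover have "ecdf n (\<lambda>i. X i \<omega>) x \<le> maj (ecdf n (\<lambda>i. X i \<omega>)) x"
        by (rule le_maj[OF ecdf_bounds(2) x])
      ultimately show "\<bar>maj (ecdf n (\<lambda>i. X i \<omega>)) x - ecdf n (\<lambda>i. X i \<omega>) x\<bar> \<le> A * \<rho> n" by simp
    qed
    \<comment> \<open>The exponent is 1/2 - 2/3 = -1/6, the rate that \<open>\<kappa>_rate\<close>
      compares with \<open>\<kappa> n\<close>.\<close>
    have rate: "sqrt (real n) * \<rho> n = ln (real n) powr (2/3) * real n powr (- 1 / 6)" if n: "3 \<le> n" for n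
    proof -
      have "sqrt (real n) * \<rho> n = real n powr (1/2) * (ln (real n) powr (2/3) / real n powr (2/3))"
        using n by (simp add: \<rho>_def powr_divide powr_half_sqrt)
      also have "\<dots> = ln (real n) powr (2/3) * (real n powr (1/2) / real n powr (2/3))" by simp
      also have "real n powr (1/2) / real n powr (2/3) = real n powr (- 1 / 6)"
        by (simp flip: powr_diff)
      finally show ?thesis .
    qed
    have "(\<lambda>n. A * C * (ln (real n) powr (2/3) * real n powr (- 1 / 6) / \<kappa> n)) \<longlonglongrightarrow> A * C * 0"
      using \<kappa>_rate by (intro tendsto_mult tendsto_const) simp
    then have "\<forall>\<^sub>F n in sequentially. A * C * (ln (real n) powr (2/3) * real n powr (- 1 / 6) / \<kappa> n) < 1"
      by (intro order_tendstoD) auto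
    moreover have "\<forall>\<^sub>F n in sequentially. 1 - \<alpha> < prob (E n)"
      using E(2) \<alpha> by (intro order_tendstoD) auto
    ultimately have "\<forall>\<^sub>F n in sequentially. ereal (prob (?ev n)) \<le> ereal \<alpha>"
      using eventually_ge_at_top[of 3]
    proof eventually_elim
      case (elim n)
      have "sqrt (real n) * (A * \<rho> n * C) < \<kappa> n"
      proof -
        have "sqrt (real n) * (A * \<rho> n * C) = A * C * (sqrt (real n) * \<rho> n)" by simp
        also have "\<dots> = A * C * (ln (real n) powr (2/3) * real n powr (- 1 / 6))"
          by (simp only: rate[OF elim(3)])
        also have "\<dots> < \<kappa> n" using elim(1) \<kappa>_pos[of n] by (simp add: divide_less_eq)
        finally show ?thesis .
      qed
      moreover have "sqrt (real n) * \<phi> g p (ecdf n (\<lambda>i. X i \<omega>)) \<le> sqrt (real n) * (A * \<rho> n * C)"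
        if "\<omega> \<in> E n" for \<omega>
        using \<phi>_le[OF elim(3) that] by (intro mult_left_mono) auto
      \<comment> \<open>The critical value is at least \<open>\<kappa> n\<close>, which the
        statistic stays below on \<open>E n\<close>.\<close>
      ultimately have "?ev n \<subseteq> space M - E n"
        by (fastforce simp: critical_value_def)
      then have "prob (?ev n) \<le> prob (space M - E n)"
        using E(1) by (intro finite_measure_mono) auto
      also have "\<dots> = 1 - prob (E n)" using E(1) by (rule prob_compl)
      finally show ?case using elim by simp
    qed
    then show ?thesis by (rule Limsup_bounded)
  qed
  moreover have "(\<lambda>n. prob (?ev n)) \<longlonglongrightarrow> 1" if H1: "\<phi> g p F > 0"
  proof -
    have maj_F: "0 \<le> maj F x - F x \<and> maj F x - F x \<le> 1" if "0 \<le> x" for x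
      using le_maj[of F 1 x] maj_le_const[of F 1 x] F01(1)[of x] F01(2) that by auto
    obtain \<delta> \<eta> where \<delta>: "0 < \<delta>" and \<eta>: "0 < \<eta>"
      and lower: "\<forall>b. set_borel_measurable lebesgue {0..} b \<longrightarrow> (\<forall>x\<ge>0. 0 \<le> b x \<and> b x \<le> 1) \<longrightarrow>
        (\<forall>x\<ge>0. \<bar>maj F x - F x - b x\<bar> \<le> \<delta>) \<longrightarrow> \<eta> \<le> wnorm g p b"
      using wnorm_lower_bound[OF p g_pos g_L1 set_borel_measurable_maj_diff[OF F01(2) Fm] maj_F
            H1[unfolded \<phi>_def]] by auto
    \<comment> \<open>Under the alternative the same modulus serves as a uniform law of large
      numbers: with constant \<open>\<delta> / 4\<close> the quadratic term is at most
      \<open>\<delta> / 4\<close>, and the remainder vanishes.\<close>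
    have "0 < \<delta> / 4" using \<delta> by simp
    then obtain A E where E: "\<And>n. E n \<in> events" "(\<lambda>n. prob (E n)) \<longlonglongrightarrow> 1"
      and modulus: "\<And>n \<omega> y z. 3 \<le> n \<Longrightarrow> \<omega> \<in> E n \<Longrightarrow>
        (ecdf n (\<lambda>i. X i \<omega>) z - F z) - (ecdf n (\<lambda>i. X i \<omega>) y - F y) \<le> \<delta> / 4 * (F z - F y)\<^sup>2 + A * \<rho> n"
      unfolding \<rho>_def using modulus_event[OF X_indep X_cdf onto] by metis
    have \<phi>_ge: "\<eta> \<le> \<phi> g p (ecdf n (\<lambda>i. X i \<omega>))"
      if n: "3 \<le> n" and \<omega>: "\<omega> \<in> E n" "\<omega> \<in> space M" and small: "A * \<rho> n \<le> \<delta> / 4" for n \<omega>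
    proof -
      let ?e = "ecdf n (\<lambda>i. X i \<omega>)"
      \<comment> \<open>At -1 both the empirical distribution and \<open>F\<close> vanish, so
        increments from this point are the deviations themselves.\<close>
      have "?e (- 1) = 0"
      proof -
        have "\<not> X i \<omega> \<le> - 1" for i using X_nonneg[OF \<omega>(2), of i] by simp
        then show ?thesis by (simp add: ecdf_def)
      qed
      moreover have sq: "\<delta> / 4 * (F x - F (- 1))\<^sup>2 \<le> \<delta> / 4" "\<delta> / 4 * (F (- 1) - F x)\<^sup>2 \<le> \<delta> / 4" for x
        using F01[of x] F_neg[of "- 1"] \<delta> by (auto simp: power_le_one intro!: mult_left_le)
      ultimately have dist: "\<bar>F x - ?e x\<bar> \<le> \<delta> / 2" for x
        using modulus[OF n \<omega>(1), of x "- 1"] modulus[OF n \<omega>(1), of "- 1" x] sq[of x] small F_neg[of "- 1"]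
        by (intro abs_leI) linarith+
      show ?thesis
        unfolding \<phi>_def
      proof (rule lower[rule_format])
        have "mono ?e"
          unfolding ecdf_def by (intro monoI mult_left_mono sum_mono) (auto simp: indicator_def)
        then have "?e \<in> borel_measurable borel" by (rule borel_measurable_mono)
        then show "set_borel_measurable lebesgue {0..} (\<lambda>x. maj ?e x - ?e x)"
          by (rule set_borel_measurable_maj_diff[OF ecdf_bounds(2)])
        fix x :: real assume x: "0 \<le> x"
        show "0 \<le> maj ?e x - ?e x \<and> maj ?e x - ?e x \<le> 1"
          using le_maj[of ?e 1 x] maj_le_const[of ?e 1 x] ecdf_bounds[of n "\<lambda>i. X i \<omega>"] x
          by (auto intro: order.trans[of _ 1] simp: algebra_simps add_increasing)
        have "\<bar>maj F x - maj ?e x\<bar> \<le> \<delta> / 2"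
          by (rule maj_dist_le[where K = 1]) (use F01 dist x in \<open>auto simp: abs_le_iff\<close>)
        then show "\<bar>maj F x - F x - (maj ?e x - ?e x)\<bar> \<le> \<delta>" using dist[of x] by linarith
      qed
    qed
    \<comment> \<open>Makes the bootstrap quantile smaller than \<open>sqrt n * \<eta>\<close>. The
      \<open>+ 1\<close> guards against \<open>C = 0\<close>, and the \<open>min\<close> secures
      \<open>\<epsilon> \<le> 2\<close>.\<close>
    define \<epsilon> where "\<epsilon> = min 1 (\<eta> / (4 * (C + 1)))"
    have \<epsilon>: "0 < \<epsilon>" "\<epsilon> \<le> 2" using \<eta> C by (auto simp: \<epsilon>_def)
    have \<epsilon>C: "2 * \<epsilon> * C < \<eta>"
    proof -
      have "2 * \<epsilon> * C \<le> 2 * (\<eta> / (4 * (C + 1))) * C" using C by (intro mult_right_mono) (auto simp: \<epsilon>_def)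
      also have "\<dots> = \<eta> / 2 * (C / (C + 1))" by (simp add: divide_simps)
      also have "\<dots> \<le> \<eta> / 2 * 1" using \<eta> C by (intro mult_left_mono) (auto simp: divide_le_eq)
      also have "\<dots> < \<eta>" using \<eta> by simp
      finally show ?thesis .
    qed
    have "(\<lambda>n. 2 * (real n + 1) * exp (- (real n * \<epsilon>\<^sup>2 / 4))) \<longlonglongrightarrow> 0"
    proof -
      have "0 < \<epsilon>\<^sup>2 / 4" using \<epsilon> by simp
      then have "(\<lambda>n. 2 * (real n + 1) * exp (- (real n * (\<epsilon>\<^sup>2 / 4)))) \<longlonglongrightarrow> 0" by real_asymp
      then show ?thesis by simp
    qed
    then have "\<forall>\<^sub>F n in sequentially. 2 * (real n + 1) * exp (- (real n * \<epsilon>\<^sup>2 / 4)) < \<alpha>"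
      using \<alpha> by (intro order_tendstoD) auto
    moreover have "(\<lambda>n. A * \<rho> n) \<longlonglongrightarrow> A * 0"
      unfolding \<rho>_def by (intro tendsto_mult tendsto_const) real_asymp
    then have "\<forall>\<^sub>F n in sequentially. A * \<rho> n < \<delta> / 4" using \<delta> by (intro order_tendstoD) auto
    moreover have "\<forall>\<^sub>F n in sequentially. \<kappa> n < \<eta>" using \<kappa>_lim \<eta> by (rule order_tendstoD)
    ultimately have "\<forall>\<^sub>F n in sequentially. prob (E n) \<le> prob (?ev n)"
      using eventually_ge_at_top[of 3]
    proof eventually_elim
      case (elim n)
      have [measurable]: "(\<lambda>\<omega>. \<phi> g p (ecdf n (\<lambda>i. X i \<omega>))) \<in> borel_measurable M"
        "(\<lambda>\<omega>. boot_quantile g p \<alpha> n (t n) (\<lambda>i. X i \<omega>)) \<in> borel_measurable M"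
        using borel_measurable_phi_ecdf[OF rv g_L1] borel_measurable_boot_quantile[OF rv g_L1 \<alpha> t_pos] elim
        by auto
      \<comment> \<open>Monotonicity of the measure requires the larger set to be an event; here
        that is the rejection set itself.\<close>
      have "?ev n \<in> events" unfolding critical_value_def by measurable
      moreover have "E n \<subseteq> ?ev n"
      proof
        fix \<omega> assume \<omega>: "\<omega> \<in> E n"
        then have space: "\<omega> \<in> space M" using E(1) sets.sets_into_space by blast
        have n1: "1 \<le> sqrt (real n)" using elim by simp
        have "1 * \<eta> \<le> sqrt (real n) * \<eta>" using n1 \<eta> by (intro mult_right_mono) auto
        then have "\<kappa> n < sqrt (real n) * \<eta>" using elim(3) by linarith
        moreover have "boot_quantile g p \<alpha> n (t n) (\<lambda>i. X i \<omega>) < sqrt (real n) * \<eta>"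
        proof -
          have "boot_quantile g p \<alpha> n (t n) (\<lambda>i. X i \<omega>) \<le> 2 * sqrt (real n) * \<epsilon> * C"
            unfolding C_def by (rule boot_quantile_le[OF p g_pos g_L1 \<alpha>(2) t_pos]) (use elim \<epsilon> in auto)
          also have "\<dots> = sqrt (real n) * (2 * \<epsilon> * C)" by simp
          also have "\<dots> < sqrt (real n) * \<eta>" using \<epsilon>C n1 by (intro mult_strict_left_mono) auto
          finally show ?thesis .
        qed
        moreover have "sqrt (real n) * \<eta> \<le> sqrt (real n) * \<phi> g p (ecdf n (\<lambda>i. X i \<omega>))"
          using \<phi>_ge[OF elim(4) \<omega> space] elim by (intro mult_left_mono) auto
        ultimately show "\<omega> \<in> ?ev n" using space by (simp add: critical_value_def)
      qed
      ultimately show ?case by (intro finite_measure_mono)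
    qed
    then show ?thesis
      by (intro tendsto_sandwich[OF _ _ E(2) tendsto_const]) auto
  qed
  ultimately show ?thesis by blast
qed

end
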